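(* Let $(W,S)$ be a Coxeter system with $S$ finite, let $\widetilde{S}$ be the smallest Garside shadow of $(W,S)$, and let $\Gamma$ be the set of gates of $W$. The automaton $\mathcal{A}_{\widetilde{S}}$ is minimal (among automata recognising the language $\mathcal{L}(W,S)$ of reduced words, with respect to the number of states) if and only if $\Gamma$ is closed under join.
   Context: $\ell$ is the length function, $e$ the identity, $D_L(w)=\{s\in S\mid\ell(sw)=\ell(w)-1\}$, and $x\preccurlyeq y$ means $\ell(x^{-1}y)=\ell(y)-\ell(x)$ (right weak order, for which every bounded subset $X$ has a least upper bound, the join $\bigvee X$). An element $u$ is a suffix of $w$ if $\ell(w)=\ell(wu^{-1})+\ell(u)$. A subset $B\subseteq W$ is closed under join if $\bigvee X\in B$ for every $X\subseteq B$ that is bounded in $(W,\preccurlyeq)$. $B\subseteq W$ is a Garside shadow if $S\subseteq B$, $B$ is closed under join, and $B$ contains all suffixes of its elements. $\widetilde{S}$ is the intersection of all Garside shadows; it is a Garside shadow and is finite. A word $(s_1,\ldots,s_n)\in S^n$ is reduced if $\ell(s_1\cdots s_n)=n$; $\mathcal{L}(W,S)$ is the set of reduced words. An automaton with alphabet $S$ is $(Y,\mu,o)$ with state set $Y$, start state $o\in Y$, dead state $\dagger\notin Y$, and $\mu:(Y\cup\{\dagger\})\times S\to Y\cup\{\dagger\}$ with $\mu(\dagger,s)=\dagger$; it recognises the set of words $(s_1,\ldots,s_n)$ with $y_n\in Y$, where $y_0=o$, $y_j=\mu(y_{j-1},s_j)$. The number of states is $|Y|$. For a Garside shadow $B$,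 let $\pi_B(w)=\bigvee\{b\in B\mid b\preccurlyeq w\}\in B$. The automaton $\mathcal{A}_B=(B,\mu,e)$, with $\mu(w,s)=\pi_B(sw)$ if $s\notin D_L(w)$ and $\mu(w,s)=\dagger$ if $s\in D_L(w)$, recognises $\mathcal{L}(W,S)$. Gates: the cone type of $x$ is $T(x)=\{y\in W\mid\ell(xy)=\ell(x)+\ell(y)\}$. For each cone type $T$ the set $X_T=\{w\in W\mid T(w^{-1})=T\}$ contains a (unique) element $g_T$ with $g_T\preccurlyeq x$ for all $x\in X_T$; $\Gamma=\{g_T\mid T\text{ a cone type}\}$. *)

theory Defs
  imports
    "HOL-Algebra.Generated_Groups"
    "HOL-Algebra.Lattice"
    "HOL-Library.Extended_Nat"
    "HOL-Library.Equipollence"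
begin

section \<open>Coxeter systems\<close>

definition word_prod :: "('a, 'b) monoid_scheme \<Rightarrow> 'a list \<Rightarrow> 'a" where
  "word_prod W ss = foldr (\<lambda>s x. s \<otimes>\<^bsub>W\<^esub> x) ss \<one>\<^bsub>W\<^esub>"

definition coxeter_matrix :: "'a set \<Rightarrow> ('a \<Rightarrow> 'a \<Rightarrow> enat) \<Rightarrow> bool" where
  "coxeter_matrix S m \<longleftrightarrow>
     (\<forall>s\<in>S. m s s = 1) \<and>
     (\<forall>s\<in>S. \<forall>t\<in>S. m s t = m t s \<and> (s \<noteq> t \<longrightarrow> 2 \<le> m s t))"

text \<open>
  Deletion of one relator \<open>(st)\<^sup>m\<close> with \<open>m = m(s,t) < \<infinity>\<close> from a word. The relators with
  \<open>s = t\<close> are \<open>ss\<close>, so every generator is its own inverse, and the words over \<open>S\<close> modulo the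
  generated equivalence are the group presented by
  \<open>\<langle> S | (st)\<^sup>m = e for m = m(s,t) < \<infinity> \<rangle>\<close>; formal inverses of the letters are not needed.
\<close>

inductive coxeter_step :: "'a set \<Rightarrow> ('a \<Rightarrow> 'a \<Rightarrow> enat) \<Rightarrow> 'a list \<Rightarrow> 'a list \<Rightarrow> bool"
  for S m where
  "\<lbrakk>s \<in> S; t \<in> S; m s t = enat k; u \<in> lists S; v \<in> lists S\<rbrakk>
    \<Longrightarrow> coxeter_step S m (u @ concat (replicate k [s, t]) @ v) (u @ v)"

definition coxeter_system :: "('a, 'b) monoid_scheme \<Rightarrow> 'a set \<Rightarrow> bool" where
  "coxeter_system W S \<longleftrightarrow>
     group W \<and> S \<subseteq> carrier W \<and> generate W S = carrier W \<and>
     (\<exists>m. coxeter_matrix S m \<and>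
        (\<forall>u\<in>lists S. \<forall>v\<in>lists S.
           word_prod W u = word_prod W v \<longleftrightarrow> equivclp (coxeter_step S m) u v))"

definition len :: "('a, 'b) monoid_scheme \<Rightarrow> 'a set \<Rightarrow> 'a \<Rightarrow> nat" where
  "len W S w = (LEAST n. \<exists>ss\<in>lists S. length ss = n \<and> word_prod W ss = w)"

definition reduced_words :: "('a, 'b) monoid_scheme \<Rightarrow> 'a set \<Rightarrow> 'a list set" where
  "reduced_words W S = {ss \<in> lists S. len W S (word_prod W ss) = length ss}"

text \<open>Here and below, equations between lengths are written without truncated subtraction.\<close>

definition left_descents :: "('a, 'b) monoid_scheme \<Rightarrow> 'a set \<Rightarrow> 'a \<Rightarrow> 'a set" where
  "left_descents W S w = {s \<in> S. len W S (s \<otimes>\<^bsub>W\<^esub> w) + 1 = len W S w}"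

definition right_weak_order :: "('a, 'b) monoid_scheme \<Rightarrow> 'a set \<Rightarrow> 'a gorder" where
  "right_weak_order W S =
     \<lparr>carrier = carrier W, eq = (=),
      le = (\<lambda>x y. len W S (inv\<^bsub>W\<^esub> x \<otimes>\<^bsub>W\<^esub> y) + len W S x = len W S y)\<rparr>"

definition is_suffix :: "('a, 'b) monoid_scheme \<Rightarrow> 'a set \<Rightarrow> 'a \<Rightarrow> 'a \<Rightarrow> bool" where
  "is_suffix W S u w \<longleftrightarrow> len W S w = len W S (w \<otimes>\<^bsub>W\<^esub> inv\<^bsub>W\<^esub> u) + len W S u"


section \<open>Garside shadows and gates\<close>

text \<open>The empty set is bounded and its join is the identity.\<close>

definition closed_under_join :: "('a, 'b) monoid_scheme \<Rightarrow> 'a set \<Rightarrow> 'a set \<Rightarrow> bool" where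
  "closed_under_join W S B \<longleftrightarrow>
     (\<forall>X\<subseteq>B. Upper (right_weak_order W S) X \<noteq> {} \<longrightarrow> \<Squnion>\<^bsub>right_weak_order W S\<^esub> X \<in> B)"

definition garside_shadow :: "('a, 'b) monoid_scheme \<Rightarrow> 'a set \<Rightarrow> 'a set \<Rightarrow> bool" where
  "garside_shadow W S B \<longleftrightarrow>
     B \<subseteq> carrier W \<and> S \<subseteq> B \<and> closed_under_join W S B \<and>
     (\<forall>w\<in>B. \<forall>u\<in>carrier W. is_suffix W S u w \<longrightarrow> u \<in> B)"

definition smallest_garside_shadow :: "('a, 'b) monoid_scheme \<Rightarrow> 'a set \<Rightarrow> 'a set" where
  "smallest_garside_shadow W S = \<Inter>{B. garside_shadow W S B}"

definition shadow_proj :: "('a, 'b) monoid_scheme \<Rightarrow> 'a set \<Rightarrow> 'a set \<Rightarrow> 'a \<Rightarrow> 'a" where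
  "shadow_proj W S B w =
     \<Squnion>\<^bsub>right_weak_order W S\<^esub> {b \<in> B. b \<sqsubseteq>\<^bsub>right_weak_order W S\<^esub> w}"

definition cone_type :: "('a, 'b) monoid_scheme \<Rightarrow> 'a set \<Rightarrow> 'a \<Rightarrow> 'a set" where
  "cone_type W S x = {y \<in> carrier W. len W S (x \<otimes>\<^bsub>W\<^esub> y) = len W S x + len W S y}"

definition cone_class :: "('a, 'b) monoid_scheme \<Rightarrow> 'a set \<Rightarrow> 'a set \<Rightarrow> 'a set" where
  "cone_class W S T = {w \<in> carrier W. cone_type W S (inv\<^bsub>W\<^esub> w) = T}"

definition gates :: "('a, 'b) monoid_scheme \<Rightarrow> 'a set \<Rightarrow> 'a set" where
  "gates W S =
     {g. \<exists>T \<in> cone_type W S ` carrier W. least (right_weak_order W S) g (cone_class W S T)}"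


section \<open>Automata\<close>

text \<open>
  The dead state is \<open>None\<close>, and a state \<open>y\<close> appears as \<open>Some y\<close>; \<open>trans\<close> is the transition
  function on the states proper, and \<open>Option.bind\<close> extends it by keeping \<open>None\<close> fixed.
\<close>

record ('s, 'q) automaton =
  states :: "'q set"
  trans :: "'q \<Rightarrow> 's \<Rightarrow> 'q option"
  start :: 'q

definition is_automaton :: "'s set \<Rightarrow> ('s, 'q) automaton \<Rightarrow> bool" where
  "is_automaton S A \<longleftrightarrow>
     start A \<in> states A \<and>
     (\<forall>y\<in>states A. \<forall>s\<in>S. trans A y s \<in> insert None (Some ` states A))"

definition run :: "('s, 'q) automaton \<Rightarrow> 's list \<Rightarrow> 'q option" where
  "run A ss = foldl (\<lambda>y s. Option.bind y (\<lambda>q. trans A q s)) (Some (start A)) ss"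

definition recognised :: "'s set \<Rightarrow> ('s, 'q) automaton \<Rightarrow> 's list set" where
  "recognised S A = {ss \<in> lists S. run A ss \<in> Some ` states A}"

text \<open>
  The number of states is compared as a cardinality, by injections; state sets are not assumed
  to be finite. The competitors \<open>A'\<close> have the state type of \<open>A\<close>. This loses nothing, as an
  automaton with at most as many states as \<open>A\<close> can be relabelled by states of \<open>A\<close>; the lemma
  \<open>minimal_automaton_lepoll\<close> below is the comparison with automata on arbitrary types.
\<close>

definition minimal_automaton :: "'s set \<Rightarrow> 's list set \<Rightarrow> ('s, 'q) automaton \<Rightarrow> bool" where
  "minimal_automaton S L A \<longleftrightarrow>
     is_automaton S A \<and> recognised S A = L \<and>
     (\<forall>A' :: ('s, 'q) automaton.
        is_automaton S A' \<and> recognised S A' = L \<longrightarrow> states A \<lesssim> states A')"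

lemma relabel_automaton:
  fixes A :: "('s, 'r) automaton" and f :: "'r \<Rightarrow> 'q"
  assumes A: "is_automaton S A" and inj: "inj_on f (states A)"
  obtains A' :: "('s, 'q) automaton"
  where "is_automaton S A'" "recognised S A' = recognised S A" "states A' = f ` states A"
proof -
  define A' :: "('s, 'q) automaton" where
    "A' = \<lparr>states = f ` states A,
           trans = (\<lambda>q s. map_option f (trans A (inv_into (states A) f q) s)),
           start = f (start A)\<rparr>"
  have aut: "is_automaton S A'"
    using A inj by (fastforce simp: is_automaton_def A'_def)
  have run: "run A' ss = map_option f (run A ss) \<and> run A ss \<in> insert None (Some ` states A)"
    if "ss \<in> lists S" for ss
    using that
  proof (induction ss rule: rev_induct)
    case Nil
    then show ?case using A by (auto simp: run_def A'_def is_automaton_def)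
  next
    case (snoc s ss)
    have snoc_run: "run B (ss @ [s]) = Option.bind (run B ss) (\<lambda>q. trans B q s)"
      for B :: "('s, 'p) automaton"
      by (simp add: run_def)
    show ?case
    proof (cases "run A ss")
      case None
      then show ?thesis using snoc by (simp add: run_def)
    next
      case (Some y)
      then have "y \<in> states A" "run A' ss = Some (f y)" "s \<in> S" using snoc by auto
      then show ?thesis
        using Some A inj by (auto simp: run_def A'_def is_automaton_def)
    qed
  qed
  have "recognised S A' = recognised S A"
    unfolding recognised_def using run by (force simp: A'_def)
  with aut that show thesis by (simp add: A'_def)
qed

lemma minimal_automaton_lepoll:
  fixes A :: "('s, 'q) automaton" and A' :: "('s, 'r) automaton"
  assumes A: "minimal_automaton S L A"
    and A': "is_automaton S A'" "recognised S A' = L"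
  shows "states A \<lesssim> states A'"
proof (rule ccontr)
  assume not_le: "\<not> states A \<lesssim> states A'"
  then have "states A' \<lesssim> states A"
    unfolding lepoll_def card_of_ordLeq
    using ordLeq_total[OF card_of_Well_order card_of_Well_order] by blast
  then obtain f :: "'r \<Rightarrow> 'q" where "inj_on f (states A')" by (auto simp: lepoll_def)
  with A' obtain A'' :: "('s, 'q) automaton"
    where "is_automaton S A''" "recognised S A'' = L" "states A'' = f ` states A'"
    by (metis relabel_automaton)
  with A have "states A \<lesssim> f ` states A'" unfolding minimal_automaton_def by metis
  then show False using not_le image_lepoll lepoll_trans by blast
qed

definition shadow_automaton ::
  "('a, 'b) monoid_scheme \<Rightarrow> 'a set \<Rightarrow> 'a set \<Rightarrow> ('a, 'a) automaton" where
  "shadow_automaton W S B =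
     \<lparr>states = B,
      trans = (\<lambda>w s. if s \<in> left_descents W S w then None
                     else Some (shadow_proj W S B (s \<otimes>\<^bsub>W\<^esub> w))),
      start = \<one>\<^bsub>W\<^esub>\<rparr>"

end

theory Submission
  imports Defs
begin

text \<open>
  Both sides of the equivalence hold: the gates always form a Garside shadow, and it is the
  smallest one.

  Every \<open>w\<close> has a finite set \<open>\<Phi> w\<close> of left inversions, its length is \<open>card (\<Phi> w)\<close>, the weak order
  is inclusion of inversion sets, and the cone type of \<open>inv w\<close> consists of the \<open>y\<close> whose inversion
  sets are disjoint from \<open>\<Phi> w\<close>. A geodesically convex set \<open>U\<close> has a least element if, whenever \<open>U\<close>
  contains \<open>z\<close> and two lower neighbours \<open>z s\<close> and \<open>z t\<close>, it contains the bottom \<open>m\<close> of the rank two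
  residue of \<open>z\<close>. This gives joins of bounded sets and, following Przytycki and Yau, the gates: if
  \<open>z\<close> and \<open>z s\<close> give the same cone type, then so do \<open>z t\<close> and \<open>m\<close>. The same fact shows that a gate
  below \<open>z\<close> is below the gate of the class of \<open>z\<close>, so that the gates are closed under join.
  Conversely, the projection to any Garside shadow preserves cone types, so it fixes gates.
  Finally, in an automaton that recognises the reduced words, the reduced words of \<open>inv g\<close> for
  different gates \<open>g\<close> lead to different states, because the state determines the cone type.
\<close>

section \<open>Inversion sets\<close>

text \<open>For a word \<open>s1 ... sn\<close> over the generators these are the reflections
  \<open>s1 ... si ... s1\<close> that occur for an odd number of indices \<open>i\<close>:
  \<open>\<noteq>\<close> between truth values is exclusive or. Counting modulo two makes the set
  depend only on the product of the word.\<close>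

fun word_inversions :: "('a, 'b) monoid_scheme \<Rightarrow> 'a list \<Rightarrow> 'a set" where
  "word_inversions W [] = {}"
| "word_inversions W (s # ss) =
     {r \<in> carrier W. (r = s) \<noteq> (inv\<^bsub>W\<^esub> s \<otimes>\<^bsub>W\<^esub> r \<otimes>\<^bsub>W\<^esub> s \<in> word_inversions W ss)}"

locale coxeter_group = group W for W (structure) +
  fixes S :: "'a set"
  assumes coxeter: "coxeter_system W S"
begin

section \<open>Conjugation and products of words\<close>

definition conj_by :: "'a \<Rightarrow> 'a \<Rightarrow> 'a" (infixr "\<rhd>" 75) where
  "x \<rhd> r = x \<otimes> r \<otimes> inv x"

lemma conj_by_closed [simp, intro]: "x \<in> carrier W \<Longrightarrow> r \<in> carrier W \<Longrightarrow> x \<rhd> r \<in> carrier W"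
  by (simp add: conj_by_def)

lemma conj_by_one [simp]: "r \<in> carrier W \<Longrightarrow> \<one> \<rhd> r = r"
  by (simp add: conj_by_def)

lemma conj_by_mult:
  "x \<in> carrier W \<Longrightarrow> y \<in> carrier W \<Longrightarrow> r \<in> carrier W \<Longrightarrow> (x \<otimes> y) \<rhd> r = x \<rhd> y \<rhd> r"
  by (simp add: conj_by_def inv_mult_group m_assoc)

lemma conj_by_inv [simp]:
  assumes "x \<in> carrier W" "r \<in> carrier W"
  shows "x \<rhd> inv x \<rhd> r = r" "inv x \<rhd> x \<rhd> r = r"
  using assms by (simp_all flip: conj_by_mult)

lemma conj_by_eq_iff:
  assumes "x \<in> carrier W" "r \<in> carrier W" "q \<in> carrier W"
  shows "x \<rhd> r = q \<longleftrightarrow> r = inv x \<rhd> q"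
  using assms by auto

lemma conj_by_inject [simp]:
  assumes "x \<in> carrier W" "r \<in> carrier W" "q \<in> carrier W"
  shows "x \<rhd> r = x \<rhd> q \<longleftrightarrow> r = q"
  using assms conj_by_inv by metis

lemma gen_closed [simp, intro]: "s \<in> S \<Longrightarrow> s \<in> carrier W"
  using coxeter by (auto simp: coxeter_system_def)

lemma lists_gen_closed: "ss \<in> lists S \<Longrightarrow> ss \<in> lists (carrier W)"
  by (induction ss rule: list.induct) auto

lemma word_prod_Nil [simp]: "word_prod W [] = \<one>"
  and word_prod_Cons [simp]: "word_prod W (s # ss) = s \<otimes> word_prod W ss"
  by (simp_all add: word_prod_def)

lemma word_prod_closed [simp]: "ss \<in> lists (carrier W) \<Longrightarrow> word_prod W ss \<in> carrier W"
  by (induction ss rule: list.induct) auto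

lemma word_prod_append:
  "u \<in> lists (carrier W) \<Longrightarrow> v \<in> lists (carrier W) \<Longrightarrow>
    word_prod W (u @ v) = word_prod W u \<otimes> word_prod W v"
  by (induction u rule: list.induct) (auto simp: m_assoc)

lemma word_prod_gen_closed [simp]: "ss \<in> lists S \<Longrightarrow> word_prod W ss \<in> carrier W"
  using lists_gen_closed by auto

lemma word_inversions_subset: "word_inversions W ss \<subseteq> carrier W"
  by (cases ss) auto

lemma mem_word_inversions_Cons:
  assumes "s \<in> carrier W" "r \<in> carrier W"
  shows "r \<in> word_inversions W (s # ss) \<longleftrightarrow> (r = s) \<noteq> (inv s \<rhd> r \<in> word_inversions W ss)"
  using assms by (simp add: conj_by_def)

text \<open>The cocycle rule for words: prefixing \<open>u\<close> conjugates the reflections of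
  \<open>v\<close> by the product of \<open>u\<close>, and reflections that occur on both sides
  cancel.\<close>

lemma mem_word_inversions_append:
  assumes "u \<in> lists (carrier W)" "v \<in> lists (carrier W)" "r \<in> carrier W"
  shows "r \<in> word_inversions W (u @ v) \<longleftrightarrow>
    (r \<in> word_inversions W u) \<noteq> (inv (word_prod W u) \<rhd> r \<in> word_inversions W v)"
  using assms
proof (induction u arbitrary: r rule: list.induct)
  case (Cons s u)
  then have "s \<in> carrier W" "u \<in> lists (carrier W)" by auto
  with Cons show ?case
    using Cons.IH[of "inv s \<rhd> r"]
    by (auto simp: mem_word_inversions_Cons inv_mult_group conj_by_mult simp del: word_inversions.simps)
qed auto

text \<open>The letters of \<open>s t s t ...\<close> contribute \<open>(s t)^i s\<close> for
  \<open>i < 2 n\<close> in this order, so membership is the parity of a count.\<close>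

lemma mem_word_inversions_dihedral:
  assumes "s \<in> S" "t \<in> S" "inv s = s" "inv t = t" "r \<in> carrier W"
  shows "r \<in> word_inversions W (concat (replicate n [s, t])) \<longleftrightarrow>
    odd (card {i. i < 2 * n \<and> (s \<otimes> t) [^] i \<otimes> s = r})"
  using assms(5)
proof (induction n arbitrary: r)
  case (Suc n)
  note [simp] = gen_closed[OF assms(1)] gen_closed[OF assms(2)]
  have ts: "inv (s \<otimes> t) = t \<otimes> s" using assms by (simp add: inv_mult_group)
  let ?A = "{i. i < 2 * n \<and> (s \<otimes> t) [^] i \<otimes> s = (t \<otimes> s) \<rhd> r}"
  let ?B = "{i. i < 2 * Suc n \<and> (s \<otimes> t) [^] i \<otimes> s = r}"
  let ?C = "{i::nat. i < 2 \<and> (s \<otimes> t) [^] i \<otimes> s = r}"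
  \<comment> \<open>Conjugation by \<open>s\<close> inverts \<open>s t\<close>, so conjugating by
    \<open>s t\<close> raises the exponent by two.\<close>
  have shift: "(s \<otimes> t) [^] (i + 2) \<otimes> s = r \<longleftrightarrow> (s \<otimes> t) [^] i \<otimes> s = (t \<otimes> s) \<rhd> r" for i :: nat
  proof -
    have st: "(s \<otimes> t) \<otimes> s = s \<otimes> inv (s \<otimes> t)" by (simp add: ts m_assoc)
    have "(s \<otimes> t) [^] (i + 2) = (s \<otimes> t) \<otimes> (s \<otimes> t) [^] i \<otimes> (s \<otimes> t)"
      using nat_pow_mult[of "s \<otimes> t" 1 i] nat_pow_mult[of "s \<otimes> t" "Suc i" 1] by simp
    then have "(s \<otimes> t) [^] (i + 2) \<otimes> s = (s \<otimes> t) \<rhd> ((s \<otimes> t) [^] i \<otimes> s)"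
      using st by (simp add: conj_by_def m_assoc)
    then show ?thesis using conj_by_eq_iff[of "s \<otimes> t" _ r] ts Suc.prems by simp
  qed
  have "?B = ?C \<union> (\<lambda>i. i + 2) ` ?A"
  proof (intro equalityI subsetI)
    fix i assume i: "i \<in> ?B"
    show "i \<in> ?C \<union> (\<lambda>i. i + 2) ` ?A"
    proof (cases "i < 2")
      case False
      then have "i = (i - 2) + 2" by simp
      then obtain j where "i = j + 2" by blast
      then show ?thesis using i shift[of j] by auto
    qed (use i in auto)
  qed (use shift in auto)
  moreover have "?C \<inter> (\<lambda>i. i + 2) ` ?A = {}" by auto
  ultimately have "card ?B = card ?C + card ?A"
    by (simp add: card_Un_disjoint card_image inj_on_def)
  moreover have "odd (card ?C) \<longleftrightarrow> (r = s) \<noteq> (r = s \<otimes> t \<otimes> s)"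
  proof -
    have "?C = {i. i = 0 \<and> r = s} \<union> {i. i = 1 \<and> r = s \<otimes> t \<otimes> s}"
      using Suc.prems assms by (auto simp: less_2_cases_iff)
    also have "{i::nat. i = 0 \<and> r = s} = (if r = s then {0} else {})" by auto
    also have "{i::nat. i = 1 \<and> r = s \<otimes> t \<otimes> s} = (if r = s \<otimes> t \<otimes> s then {1} else {})" by auto
    finally show ?thesis by simp
  qed
  moreover have "r \<in> word_inversions W (concat (replicate (Suc n) [s, t])) \<longleftrightarrow>
      ((r = s) \<noteq> ((s \<rhd> r = t) \<noteq> (t \<rhd> s \<rhd> r \<in> word_inversions W (concat (replicate n [s, t])))))"
    using assms Suc.prems
    by (simp add: mem_word_inversions_Cons del: word_inversions.simps)
  moreover have "s \<rhd> r = t \<longleftrightarrow> r = s \<otimes> t \<otimes> s"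
    using conj_by_eq_iff[of s r t] assms Suc.prems by (auto simp: conj_by_def)
  moreover have "(t \<otimes> s) \<rhd> r = t \<rhd> s \<rhd> r" using Suc.prems by (simp add: conj_by_mult)
  ultimately show ?case using Suc.IH[of "t \<rhd> s \<rhd> r"] Suc.prems by auto
qed simp

text \<open>The exponent \<open>m s s = 1\<close> makes the word \<open>[s, s]\<close> itself a
  relator.\<close>

lemma gen_square: "s \<in> S \<Longrightarrow> s \<otimes> s = \<one>"
proof -
  assume s: "s \<in> S"
  obtain m where m: "coxeter_matrix S m"
    and rel: "\<And>u v. u \<in> lists S \<Longrightarrow> v \<in> lists S \<Longrightarrow>
      word_prod W u = word_prod W v \<longleftrightarrow> equivclp (coxeter_step S m) u v"
    using coxeter unfolding coxeter_system_def by blast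
  have "m s s = enat 1" using m s by (auto simp: coxeter_matrix_def one_enat_def)
  then have "coxeter_step S m [s, s] []"
    using coxeter_step.intros[of s S s m 1 "[]" "[]"] s by simp
  then have "equivclp (coxeter_step S m) [s, s] []" by (rule r_into_equivclp)
  then show ?thesis using rel[of "[s, s]" "[]"] s by simp
qed

lemma gen_inv [simp]: "s \<in> S \<Longrightarrow> inv s = s"
  using gen_square by (simp add: inv_equality)

text \<open>The Coxeter relations enter here. In a relator \<open>(s t)^k\<close> the reflections
  \<open>(s t)^i s\<close> for \<open>i < 2 k\<close> have period \<open>k\<close> in
  \<open>i\<close>, so each occurs an even number of times. The relator therefore has no inversions
  and product \<open>\<one>\<close>, and by the cocycle rule deleting it changes nothing.\<close>

lemma word_inversions_cong:
  assumes "u \<in> lists S" "v \<in> lists S" "word_prod W u = word_prod W v"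
  shows "word_inversions W u = word_inversions W v"
proof -
  obtain m where rel: "\<And>u v. u \<in> lists S \<Longrightarrow> v \<in> lists S \<Longrightarrow>
      word_prod W u = word_prod W v \<longleftrightarrow> equivclp (coxeter_step S m) u v"
    using coxeter unfolding coxeter_system_def by blast
  have step: "word_inversions W a = word_inversions W b" if "coxeter_step S m a b" for a b
    using that
  proof cases
    case (1 s t k u v)
    define c where "c = concat (replicate k [s, t])"
    have c: "c \<in> lists S" using 1 by (auto simp: c_def split: if_splits)
    have [simp]: "s \<in> carrier W" "t \<in> carrier W" using 1 by auto
    have "coxeter_step S m c []"
      using coxeter_step.intros[of s S t m k "[]" "[]"] 1 by (simp add: c_def)
    then have prod: "word_prod W c = \<one>"
      using rel[OF c, of "[]"] by (simp add: r_into_equivclp)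
    moreover have "word_prod W (concat (replicate n [s, t])) = (s \<otimes> t) [^] n" for n
    proof (induction n)
      case (Suc n)
      then show ?case using nat_pow_Suc2[of "s \<otimes> t" n] by (simp add: m_assoc)
    qed simp
    ultimately have pow: "(s \<otimes> t) [^] k = \<one>" by (simp add: c_def)
    have "r \<notin> word_inversions W c" if r: "r \<in> carrier W" for r
    proof -
      let ?P = "\<lambda>i. (s \<otimes> t) [^] i \<otimes> s = r"
      have per: "?P (i + k) \<longleftrightarrow> ?P i" for i
        using pow nat_pow_mult[of "s \<otimes> t" i k] by simp
      have "{i. i < 2 * k \<and> ?P i} = {i. i < k \<and> ?P i} \<union> (\<lambda>i. i + k) ` {i. i < k \<and> ?P i}"
      proof (intro equalityI subsetI)
        fix i assume i: "i \<in> {i. i < 2 * k \<and> ?P i}"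
        show "i \<in> {i. i < k \<and> ?P i} \<union> (\<lambda>i. i + k) ` {i. i < k \<and> ?P i}"
        proof (cases "i < k")
          case False
          then have "i = (i - k) + k" by simp
          then obtain j where "i = j + k" by blast
          then show ?thesis using i per[of j] by auto
        qed (use i in auto)
      qed (use per in auto)
      moreover have "{i. i < k \<and> ?P i} \<inter> (\<lambda>i. i + k) ` {i. i < k \<and> ?P i} = {}" by auto
      ultimately have "card {i. i < 2 * k \<and> ?P i} = 2 * card {i. i < k \<and> ?P i}"
        by (simp add: card_Un_disjoint card_image)
      then show ?thesis
        using mem_word_inversions_dihedral[of s t r k] 1 r by (simp add: c_def)
    qed
    then have inv_c: "word_inversions W c = {}" using word_inversions_subset by blast
    have car: "u \<in> lists (carrier W)" "v \<in> lists (carrier W)" "c \<in> lists (carrier W)"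
      using 1 c lists_gen_closed by auto
    have "r \<in> word_inversions W (u @ c @ v) \<longleftrightarrow> r \<in> word_inversions W (u @ v)"
      if "r \<in> carrier W" for r
      using car that prod inv_c
      by (simp add: mem_word_inversions_append word_prod_append)
    then show ?thesis
      using word_inversions_subset[of "u @ c @ v"] word_inversions_subset[of "u @ v"] 1
      unfolding c_def by blast
  qed
  have "equivclp (coxeter_step S m) u v" using rel assms by blast
  then show ?thesis by (induction rule: equivclp_induct) (auto dest: step)
qed

lemma word_exists: "w \<in> carrier W \<Longrightarrow> \<exists>ss\<in>lists S. word_prod W ss = w"
proof -
  assume "w \<in> carrier W"
  then have "w \<in> generate W S" using coxeter by (simp add: coxeter_system_def)
  then show ?thesis
  proof (induction rule: generate.induct)
    case one
    show ?case by (rule bexI[of _ "[]"]) auto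
  next
    case (incl h)
    then show ?case by (intro bexI[of _ "[h]"]) auto
  next
    case (inv h)
    then show ?case by (intro bexI[of _ "[h]"]) auto
  next
    case (eng h1 h2)
    then obtain u v where "u \<in> lists S" "word_prod W u = h1" "v \<in> lists S" "word_prod W v = h2"
      by blast
    then show ?case by (intro bexI[of _ "u @ v"]) (auto simp: word_prod_append lists_gen_closed)
  qed
qed

text \<open>The left inversion set of \<open>w\<close>. By \<open>word_inversions_cong\<close> it is
  the same for every word that the choice may return.\<close>

definition inversions :: "'a \<Rightarrow> 'a set" ("\<Phi>") where
  "\<Phi> w = word_inversions W (SOME ss. ss \<in> lists S \<and> word_prod W ss = w)"

lemma inversions_word_prod: "ss \<in> lists S \<Longrightarrow> \<Phi> (word_prod W ss) = word_inversions W ss"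
  unfolding inversions_def
  by (rule someI2[of _ ss]) (use word_inversions_cong in blast)+

lemma inversions_subset: "\<Phi> w \<subseteq> carrier W"
  by (simp add: inversions_def word_inversions_subset)

lemma inversions_closed: "r \<in> \<Phi> w \<Longrightarrow> r \<in> carrier W"
  using inversions_subset by blast

lemma inversions_one [simp]: "\<Phi> \<one> = {}"
  using inversions_word_prod[of "[]"] by simp

lemma inversions_gen [simp]: "s \<in> S \<Longrightarrow> \<Phi> s = {s}"
  using inversions_word_prod[of "[s]"] by auto

text \<open>The cocycle rule freed from the choice of words: up to conjugation by \<open>x\<close>,
  the inversion sets of the factors combine by symmetric difference.\<close>

lemma mem_inversions_mult:
  assumes "x \<in> carrier W" "y \<in> carrier W" "r \<in> carrier W"
  shows "r \<in> \<Phi> (x \<otimes> y) \<longleftrightarrow> (r \<in> \<Phi> x) \<noteq> (inv x \<rhd> r \<in> \<Phi> y)"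
proof -
  obtain u v where uv: "u \<in> lists S" "v \<in> lists S" "word_prod W u = x" "word_prod W v = y"
    using word_exists[OF assms(1)] word_exists[OF assms(2)] by blast
  then have "x \<otimes> y = word_prod W (u @ v)" by (simp add: word_prod_append lists_gen_closed)
  moreover have "u @ v \<in> lists S" using uv by simp
  ultimately have "\<Phi> (x \<otimes> y) = word_inversions W (u @ v)"
    using inversions_word_prod[of "u @ v"] by simp
  moreover have "\<Phi> x = word_inversions W u" "\<Phi> y = word_inversions W v"
    using inversions_word_prod[OF uv(1)] inversions_word_prod[OF uv(2)] uv(3,4) by simp_all
  ultimately show ?thesis
    using assms mem_word_inversions_append[OF uv(1,2)[THEN lists_gen_closed], of r] uv(3)
    by (simp only:)
qed

lemma mem_inversions_inv:
  assumes "x \<in> carrier W" "r \<in> carrier W"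
  shows "r \<in> \<Phi> (inv x) \<longleftrightarrow> x \<rhd> r \<in> \<Phi> x"
  using mem_inversions_mult[of x "inv x" "x \<rhd> r"] assms by simp

text \<open>If \<open>r\<close> is the first letter, that letter is dropped; otherwise
  \<open>r\<close> is conjugated past it into the tail. The lemma is also applied to unreduced
  words, in \<open>parabolic_descent_exists\<close>, where the condition on \<open>set ss'\<close>
  keeps the new word over the same letters.\<close>

lemma strong_exchange:
  assumes "ss \<in> lists S" "r \<in> word_inversions W ss"
  shows "\<exists>ss'. length ss = Suc (length ss') \<and> set ss' \<subseteq> set ss \<and> word_prod W ss' = r \<otimes> word_prod W ss"
  using assms
proof (induction ss arbitrary: r rule: list.induct)
  case (Cons s ss)
  then have [simp]: "s \<in> S" "s \<in> carrier W" "r \<in> carrier W" "word_prod W ss \<in> carrier W"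
    using word_inversions_subset by auto
  have ss: "s \<otimes> (s \<otimes> x) = x" if "x \<in> carrier W" for x
    using gen_square that by (simp flip: m_assoc)
  show ?case
  proof (cases "r = s")
    case True
    then show ?thesis by (intro exI[of _ ss]) (auto simp: ss)
  next
    case False
    then have "s \<rhd> r \<in> word_inversions W ss"
      using Cons.prems by (simp add: conj_by_def)
    then obtain u where u: "length ss = Suc (length u)" "set u \<subseteq> set ss"
      "word_prod W u = (s \<rhd> r) \<otimes> word_prod W ss"
      using Cons.IH[of "s \<rhd> r"] Cons.prems(1) by (fastforce simp del: word_inversions.simps)
    have "word_prod W (s # u) = r \<otimes> word_prod W (s # ss)"
      by (simp add: u(3) conj_by_def m_assoc ss)
    then show ?thesis using u(1,2) by (intro exI[of _ "s # u"]) auto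
  qed
qed simp

section \<open>Length as the number of inversions\<close>

lemma len_le: "ss \<in> lists S \<Longrightarrow> len W S (word_prod W ss) \<le> length ss"
  unfolding len_def by (rule Least_le) auto

lemma reduced_word_exists:
  assumes "w \<in> carrier W"
  obtains ss where "ss \<in> lists S" "word_prod W ss = w" "length ss = len W S w"
proof -
  have "\<exists>n. \<exists>ss\<in>lists S. length ss = n \<and> word_prod W ss = w"
    using word_exists[OF assms] by blast
  from LeastI_ex[OF this] that show thesis unfolding len_def by blast
qed

lemma finite_word_inversions:
  assumes "ss \<in> lists S" shows "finite (word_inversions W ss)"
  using assms
proof (induction ss rule: list.induct)
  case (Cons s ss)
  then have s: "s \<in> S" by auto
  have "word_inversions W (s # ss) \<subseteq> insert s ((\<rhd>) s ` word_inversions W ss)"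
  proof
    fix r assume "r \<in> word_inversions W (s # ss)"
    then have "r \<in> carrier W" "r = s \<or> s \<rhd> r \<in> word_inversions W ss"
      using s by (auto simp: conj_by_def)
    moreover have "r = s \<rhd> s \<rhd> r" using conj_by_inv(1)[of s r] s \<open>r \<in> carrier W\<close> by simp
    ultimately show "r \<in> insert s ((\<rhd>) s ` word_inversions W ss)" by blast
  qed
  then show ?case using Cons finite_subset by auto
qed simp

lemma finite_inversions [simp]: "w \<in> carrier W \<Longrightarrow> finite (\<Phi> w)"
  using word_exists[of w] inversions_word_prod finite_word_inversions by fastforce

lemma inversions_gen_mult:
  assumes "s \<in> S" "w \<in> carrier W"
  shows "s \<notin> \<Phi> w \<Longrightarrow> \<Phi> (s \<otimes> w) = insert s ((\<rhd>) s ` \<Phi> w)"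
    and "s \<in> \<Phi> w \<Longrightarrow> \<Phi> (s \<otimes> w) = (\<rhd>) s ` (\<Phi> w - {s})"
proof -
  have conj_s: "s \<rhd> s = s" using assms gen_square by (simp add: conj_by_def m_assoc)
  have mem: "r \<in> \<Phi> (s \<otimes> w) \<longleftrightarrow> (r = s) \<noteq> (s \<rhd> r \<in> \<Phi> w)" if "r \<in> carrier W" for r
    using mem_inversions_mult[of s w r] assms that by simp
  have inv: "s \<rhd> s \<rhd> r = r" if "r \<in> carrier W" for r
    using conj_by_inv(1)[of s r] assms that by simp
  show "\<Phi> (s \<otimes> w) = insert s ((\<rhd>) s ` \<Phi> w)" if "s \<notin> \<Phi> w"
  proof (intro equalityI subsetI)
    fix r assume "r \<in> \<Phi> (s \<otimes> w)"
    moreover from this have "r \<in> carrier W" by (rule inversions_closed)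
    ultimately show "r \<in> insert s ((\<rhd>) s ` \<Phi> w)" using mem[of r] inv[of r] by force
  next
    fix r assume r: "r \<in> insert s ((\<rhd>) s ` \<Phi> w)"
    then have "r \<in> carrier W" using assms inversions_closed by auto
    then show "r \<in> \<Phi> (s \<otimes> w)" using r mem[of r] inv conj_s that assms inversions_closed by auto
  qed
  show "\<Phi> (s \<otimes> w) = (\<rhd>) s ` (\<Phi> w - {s})" if "s \<in> \<Phi> w"
  proof (intro equalityI subsetI)
    fix r assume "r \<in> \<Phi> (s \<otimes> w)"
    moreover from this have "r \<in> carrier W" by (rule inversions_closed)
    ultimately show "r \<in> (\<rhd>) s ` (\<Phi> w - {s})"
      using mem[of r] inv[of r] conj_s that by (metis (no_types, lifting) Diff_iff image_eqI singletonD)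
  next
    fix r assume r: "r \<in> (\<rhd>) s ` (\<Phi> w - {s})"
    then have rc: "r \<in> carrier W" using assms inversions_closed by auto
    obtain q where q: "q \<in> \<Phi> w" "q \<noteq> s" "r = s \<rhd> q" using r by auto
    then have "s \<rhd> r = q" using inv inversions_closed by simp
    then show "r \<in> \<Phi> (s \<otimes> w)" using mem[OF rc] q conj_s by auto
  qed
qed

text \<open>In a reduced word no letter is an inversion of the tail after it, since exchange would
  then give a shorter word for the same product. So each letter adds exactly one inversion.\<close>

lemma len_eq_card: "w \<in> carrier W \<Longrightarrow> len W S w = card (\<Phi> w)"
proof -
  have *: "card (word_inversions W ss) = length ss"
    if "ss \<in> lists S" "len W S (word_prod W ss) = length ss" for ss
    using that
  proof (induction ss rule: list.induct)
    case (Cons s ss)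
    then have s: "s \<in> S" and ss: "ss \<in> lists S" by auto
    \<comment> \<open>A shortest word \<open>u\<close> for the tail shows that the tail is itself
      reduced.\<close>
    obtain u where u: "u \<in> lists S" "word_prod W u = word_prod W ss"
      "length u = len W S (word_prod W ss)"
      using reduced_word_exists[of "word_prod W ss"] ss by auto
    have "len W S (word_prod W (s # u)) \<le> Suc (length u)"
      using len_le[of "s # u"] s u by simp
    then have red: "len W S (word_prod W ss) = length ss"
      using u Cons.prems(2) len_le[OF ss] by simp
    have "s \<notin> word_inversions W ss"
    proof
      assume "s \<in> word_inversions W ss"
      then obtain ss' where ss': "length ss = Suc (length ss')" "set ss' \<subseteq> set ss"
        "word_prod W ss' = word_prod W (s # ss)"
        using strong_exchange[OF ss, of s] by auto
      moreover have "ss' \<in> lists S" using ss' ss by auto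
      ultimately show False using len_le[of ss'] Cons.prems(2) by simp
    qed
    moreover from this have "\<Phi> (s \<otimes> word_prod W ss) = insert s ((\<rhd>) s ` \<Phi> (word_prod W ss))"
      using inversions_gen_mult(1) inversions_word_prod s ss by simp
    ultimately have eq: "word_inversions W (s # ss) = insert s ((\<rhd>) s ` word_inversions W ss)"
      using inversions_word_prod[OF ss] inversions_word_prod[of "s # ss"] s ss by simp
    have "inj_on ((\<rhd>) s) (word_inversions W ss)"
      using s conj_by_inject subsetD[OF word_inversions_subset[of ss]]
      by (intro inj_onI) (metis gen_closed)
    moreover have "s \<notin> (\<rhd>) s ` word_inversions W ss"
    proof
      assume "s \<in> (\<rhd>) s ` word_inversions W ss"
      then obtain q where q: "q \<in> word_inversions W ss" "s = s \<rhd> q" by auto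
      have "s = s \<rhd> s" using s gen_square by (simp add: conj_by_def m_assoc)
      with q have "q = s"
        using s word_inversions_subset[of ss] conj_by_inject[of s q s] by auto
      with q \<open>s \<notin> word_inversions W ss\<close> show False by simp
    qed
    ultimately show ?case
      unfolding eq using Cons.IH[OF ss red] finite_word_inversions[OF ss]
      by (simp add: card_image)
  qed simp
  assume "w \<in> carrier W"
  then obtain ss where "ss \<in> lists S" "word_prod W ss = w" "length ss = len W S w"
    using reduced_word_exists by blast
  then show ?thesis using *[of ss] inversions_word_prod[of ss] by simp
qed

section \<open>Comparing elements through their inversion sets\<close>

lemma conj_by_gen [simp]: "s \<in> S \<Longrightarrow> s \<rhd> s = s"
  using gen_square by (simp add: conj_by_def m_assoc)

lemma conj_by_mult_right:
  "x \<in> carrier W \<Longrightarrow> q \<in> carrier W \<Longrightarrow> r \<in> carrier W \<Longrightarrow> x \<rhd> (q \<otimes> r) = (x \<rhd> q) \<otimes> (x \<rhd> r)"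
proof -
  assume *: "x \<in> carrier W" "q \<in> carrier W" "r \<in> carrier W"
  then have "inv x \<otimes> (x \<otimes> (r \<otimes> inv x)) = r \<otimes> inv x" by (simp flip: m_assoc)
  with * show ?thesis by (simp add: conj_by_def m_assoc)
qed

lemma conj_gen_square: "x \<in> carrier W \<Longrightarrow> s \<in> S \<Longrightarrow> (x \<rhd> s) \<otimes> (x \<rhd> s) = \<one>"
  using conj_by_mult_right[of x s s] gen_square by (simp add: conj_by_def)

lemma mem_inversions_inv_mult:
  assumes "x \<in> carrier W" "y \<in> carrier W" "r \<in> carrier W"
  shows "r \<in> \<Phi> (inv x \<otimes> y) \<longleftrightarrow> (x \<rhd> r \<in> \<Phi> x) \<noteq> (x \<rhd> r \<in> \<Phi> y)"
  using assms mem_inversions_mult[of "inv x" y r] mem_inversions_inv[of x r] by simp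

text \<open>In the cocycle identity \<open>\<Phi> (inv x)\<close> is \<open>\<Phi> x\<close>
  conjugated by \<open>inv x\<close>, which leaves the reflections that separate \<open>x\<close>
  from \<open>y\<close>. Their number is the distance of \<open>x\<close> and \<open>y\<close> in
  the Cayley graph.\<close>

lemma inversions_inv_mult:
  assumes "x \<in> carrier W" "y \<in> carrier W"
  shows "\<Phi> (inv x \<otimes> y) = (\<rhd>) (inv x) ` ((\<Phi> x - \<Phi> y) \<union> (\<Phi> y - \<Phi> x))"
proof (intro equalityI subsetI)
  fix r assume r: "r \<in> \<Phi> (inv x \<otimes> y)"
  then have "r \<in> carrier W" by (rule inversions_closed)
  then have "r = inv x \<rhd> x \<rhd> r" "x \<rhd> r \<in> (\<Phi> x - \<Phi> y) \<union> (\<Phi> y - \<Phi> x)"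
    using r assms mem_inversions_inv_mult by auto
  then show "r \<in> (\<rhd>) (inv x) ` ((\<Phi> x - \<Phi> y) \<union> (\<Phi> y - \<Phi> x))" by blast
next
  fix r assume "r \<in> (\<rhd>) (inv x) ` ((\<Phi> x - \<Phi> y) \<union> (\<Phi> y - \<Phi> x))"
  then obtain q where q: "q \<in> (\<Phi> x - \<Phi> y) \<union> (\<Phi> y - \<Phi> x)" "r = inv x \<rhd> q" by blast
  then have "q \<in> carrier W" using inversions_closed by blast
  then show "r \<in> \<Phi> (inv x \<otimes> y)"
    using q assms mem_inversions_inv_mult[of x y r] by auto
qed

lemma card_inversions_inv_mult:
  assumes "x \<in> carrier W" "y \<in> carrier W"
  shows "card (\<Phi> (inv x \<otimes> y)) = card ((\<Phi> x - \<Phi> y) \<union> (\<Phi> y - \<Phi> x))"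
proof -
  have "inj_on ((\<rhd>) (inv x)) (carrier W)" using assms by (auto intro: inj_onI)
  then have "inj_on ((\<rhd>) (inv x)) ((\<Phi> x - \<Phi> y) \<union> (\<Phi> y - \<Phi> x))"
    by (rule inj_on_subset) (use inversions_subset in blast)
  then show ?thesis using assms by (simp add: inversions_inv_mult card_image)
qed

lemma card_inversions_inv: "x \<in> carrier W \<Longrightarrow> card (\<Phi> (inv x)) = card (\<Phi> x)"
  using card_inversions_inv_mult[of x \<one>] by simp

lemma inversions_empty_iff [simp]: "w \<in> carrier W \<Longrightarrow> \<Phi> w = {} \<longleftrightarrow> w = \<one>"
  using reduced_word_exists[of w] len_eq_card[of w]
  by (metis card.empty inversions_one length_0_conv word_prod_Nil)

lemma inversions_inject:
  assumes "x \<in> carrier W" "y \<in> carrier W" "\<Phi> x = \<Phi> y"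
  shows "x = y"
proof -
  have "\<Phi> (inv x \<otimes> y) = {}" using assms inversions_inv_mult[of x y] by simp
  then have "inv x \<otimes> y = \<one>" using assms by simp
  then show ?thesis using assms inv_solve_left[of \<one> x y] by simp
qed

text \<open>As \<open>\<Phi> x = {x}\<close>, an edge of the Cayley graph crosses the single wall
  \<open>u \<rhd> x\<close>.\<close>

lemma inversions_mult_gen:
  assumes "u \<in> carrier W" "x \<in> S"
  shows "\<Phi> (u \<otimes> x) = (if u \<rhd> x \<in> \<Phi> u then \<Phi> u - {u \<rhd> x} else insert (u \<rhd> x) (\<Phi> u))"
proof -
  have mem: "r \<in> \<Phi> (u \<otimes> x) \<longleftrightarrow> (r \<in> \<Phi> u) \<noteq> (r = u \<rhd> x)" if "r \<in> carrier W" for r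
    using assms that mem_inversions_mult[of u x r] conj_by_eq_iff[of "inv u" r x] by simp
  show ?thesis
    using mem inversions_closed[of _ "u \<otimes> x"] inversions_closed[of _ u] conj_by_closed[of u x] assms
    by (auto split: if_splits)
qed

lemma right_descent_iff:
  assumes "u \<in> carrier W" "x \<in> S"
  shows "u \<rhd> x \<in> \<Phi> u \<longleftrightarrow> x \<in> \<Phi> (inv u)"
  using assms mem_inversions_inv[of u x] by simp

lemma card_reflection_mult_less:
  assumes "w \<in> carrier W" "r \<in> \<Phi> w"
  shows "card (\<Phi> (r \<otimes> w)) < card (\<Phi> w)"
proof -
  obtain ss where ss: "ss \<in> lists S" "word_prod W ss = w" "length ss = len W S w"
    using reduced_word_exists[OF assms(1)] by blast
  then have "r \<in> word_inversions W ss" using assms inversions_word_prod[OF ss(1)] by simp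
  then obtain ss' where ss': "length ss = Suc (length ss')" "set ss' \<subseteq> set ss"
    "word_prod W ss' = r \<otimes> w"
    using strong_exchange[OF ss(1)] ss(2) by blast
  then have "ss' \<in> lists S" using ss(1) by auto
  then have "len W S (r \<otimes> w) < len W S w" using len_le[of ss'] ss ss' by simp
  then show ?thesis using assms inversions_closed len_eq_card by simp
qed

text \<open>The cocycle identity is applied twice to \<open>m \<otimes> s \<otimes> inv m\<close>.
  The result decides which reflections of a residue are inversions of the reflection
  \<open>m \<rhd> s\<close>.\<close>

lemma mem_inversions_conj:
  assumes "m \<in> carrier W" "s \<in> S" "r \<in> carrier W"
  shows "r \<in> \<Phi> (m \<rhd> s) \<longleftrightarrow> (r \<in> \<Phi> m) \<noteq> ((r = m \<rhd> s) \<noteq> ((m \<rhd> s) \<rhd> r \<in> \<Phi> m))"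
proof -
  have "m \<rhd> s = m \<otimes> (s \<otimes> inv m)" using assms by (simp add: conj_by_def m_assoc)
  moreover have "(m \<rhd> s) \<rhd> r = m \<rhd> s \<rhd> inv m \<rhd> r"
    using assms by (simp add: conj_by_def[of m s] conj_by_mult)
  moreover have "inv m \<rhd> r = s \<longleftrightarrow> r = m \<rhd> s" using assms conj_by_eq_iff[of "inv m" r s] by simp
  ultimately show ?thesis
    using assms mem_inversions_mult[of m "s \<otimes> inv m" r] mem_inversions_mult[of s "inv m" "inv m \<rhd> r"]
      mem_inversions_inv[of m "s \<rhd> inv m \<rhd> r"] by simp
qed

section \<open>Residues\<close>

definition parabolic :: "'a set \<Rightarrow> 'a set" where
  "parabolic J = word_prod W ` lists J"

definition parabolic_reflections :: "'a set \<Rightarrow> 'a set" where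
  "parabolic_reflections J = {v \<rhd> s | v s. v \<in> parabolic J \<and> s \<in> J}"

context
  fixes J assumes J: "J \<subseteq> S"
begin

lemma parabolic_subset: "parabolic J \<subseteq> carrier W"
  using J unfolding parabolic_def by (auto intro!: word_prod_gen_closed)

lemma parabolic_closed: "v \<in> parabolic J \<Longrightarrow> v \<in> carrier W"
  using parabolic_subset by blast

lemma one_parabolic: "\<one> \<in> parabolic J"
  unfolding parabolic_def by (rule image_eqI[of _ _ "[]"]) auto

lemma gen_parabolic: "s \<in> J \<Longrightarrow> s \<in> parabolic J"
  unfolding parabolic_def using J by (intro image_eqI[of _ _ "[s]"]) auto

lemma mult_parabolic: "u \<in> parabolic J \<Longrightarrow> v \<in> parabolic J \<Longrightarrow> u \<otimes> v \<in> parabolic J"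
proof -
  assume "u \<in> parabolic J" "v \<in> parabolic J"
  then obtain a b where ab: "a \<in> lists J" "u = word_prod W a" "b \<in> lists J" "v = word_prod W b"
    unfolding parabolic_def by blast
  then have "a \<in> lists (carrier W)" "b \<in> lists (carrier W)" using J by auto
  then have "u \<otimes> v = word_prod W (a @ b)" using ab by (simp add: word_prod_append)
  moreover have "a @ b \<in> lists J" using ab by simp
  ultimately show ?thesis unfolding parabolic_def by blast
qed

lemma parabolic_induct [consumes 1, case_names one mult]:
  assumes "v \<in> parabolic J" "P \<one>"
    and "\<And>s v. s \<in> J \<Longrightarrow> v \<in> parabolic J \<Longrightarrow> P v \<Longrightarrow> P (s \<otimes> v)"
  shows "P v"
proof -
  obtain a where "a \<in> lists J" "v = word_prod W a" using assms(1) unfolding parabolic_def by blast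
  from this(1) have "P (word_prod W a)"
    by (induction a) (use assms in \<open>auto simp: parabolic_def\<close>)
  then show ?thesis using \<open>v = word_prod W a\<close> by simp
qed

lemma inv_parabolic: "v \<in> parabolic J \<Longrightarrow> inv v \<in> parabolic J"
proof (induction rule: parabolic_induct)
  case (mult s v)
  then have "s \<in> S" "v \<in> carrier W" using J parabolic_closed by auto
  then show ?case using mult mult_parabolic gen_parabolic by (simp add: inv_mult_group)
qed (simp add: one_parabolic)

lemma parabolic_reflections_closed: "r \<in> parabolic_reflections J \<Longrightarrow> r \<in> carrier W"
  unfolding parabolic_reflections_def using parabolic_closed J by auto

lemma gen_parabolic_reflections: "s \<in> J \<Longrightarrow> s \<in> parabolic_reflections J"
proof -
  assume s: "s \<in> J"
  then have "s = \<one> \<rhd> s" using J by auto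
  with s one_parabolic show ?thesis unfolding parabolic_reflections_def by blast
qed

lemma parabolic_reflections_parabolic: "r \<in> parabolic_reflections J \<Longrightarrow> r \<in> parabolic J"
  unfolding parabolic_reflections_def conj_by_def
  by (auto intro: mult_parabolic inv_parabolic gen_parabolic)

lemma parabolic_reflections_square: "r \<in> parabolic_reflections J \<Longrightarrow> r \<otimes> r = \<one>"
  unfolding parabolic_reflections_def using conj_gen_square parabolic_closed J by blast

lemma conj_parabolic_reflections:
  assumes "v \<in> parabolic J" "r \<in> parabolic_reflections J"
  shows "v \<rhd> r \<in> parabolic_reflections J"
proof -
  obtain u s where us: "u \<in> parabolic J" "s \<in> J" "r = u \<rhd> s"
    using assms(2) unfolding parabolic_reflections_def by blast
  then have "s \<in> carrier W" using J by auto
  then have "v \<rhd> r = (v \<otimes> u) \<rhd> s"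
    using us assms(1) by (simp add: conj_by_mult parabolic_closed)
  then show ?thesis unfolding parabolic_reflections_def using us assms(1) mult_parabolic by blast
qed

lemma inversions_parabolic: "v \<in> parabolic J \<Longrightarrow> \<Phi> v \<subseteq> parabolic_reflections J"
proof (induction rule: parabolic_induct)
  case (mult s v)
  then have s: "s \<in> S" and v: "v \<in> carrier W" using J parabolic_closed by auto
  show ?case
    using inversions_gen_mult[OF s v] mult conj_parabolic_reflections gen_parabolic
      gen_parabolic_reflections by (cases "s \<in> \<Phi> v") auto
qed simp

text \<open>Start from any word for \<open>v\<close> over \<open>J\<close>. If its first letter is
  no descent of \<open>v\<close>, it is an inversion of the tail, and exchange gives a word for
  \<open>v\<close> over \<open>J\<close> with two letters fewer. As
  \<open>v \<noteq> \<one>\<close>, this must stop at a descent.\<close>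

lemma parabolic_descent_exists:
  assumes "v \<in> parabolic J" "v \<noteq> \<one>"
  obtains s where "s \<in> J" "s \<in> \<Phi> v"
proof -
  obtain a where a: "a \<in> lists J" "v = word_prod W a" using assms(1) unfolding parabolic_def by blast
  then have "\<exists>s\<in>J. s \<in> \<Phi> v" using assms(2)
  proof (induction "length a" arbitrary: a rule: less_induct)
    case less
    then obtain s u where s: "a = s # u" by (cases a) auto
    then have sJ: "s \<in> J" "u \<in> lists J" using less.prems by auto
    then have sS: "s \<in> S" "u \<in> lists S" using J by auto
    show ?case
    proof (cases "s \<in> \<Phi> v")
      case True
      then show ?thesis using sJ by blast
    next
      case False
      have "v = s \<otimes> word_prod W u" using less.prems s by simp
      then have "s \<in> \<Phi> (word_prod W u)"
        using False mem_inversions_mult[of s "word_prod W u" s] sS by auto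
      then have "s \<in> word_inversions W u" using inversions_word_prod sS by simp
      then obtain u' where u': "length u = Suc (length u')" "set u' \<subseteq> set u"
        "word_prod W u' = s \<otimes> word_prod W u"
        using strong_exchange[OF sS(2)] by blast
      have "u' \<in> lists J" using u'(2) sJ by auto
      moreover have "v = word_prod W u'" using u'(3) \<open>v = s \<otimes> word_prod W u\<close> by simp
      moreover have "length u' < length a" using u'(1) s by simp
      ultimately show ?thesis using less.hyps[of u'] less.prems(3) by blast
    qed
  qed
  then show thesis using that by blast
qed

text \<open>Take \<open>v\<close> so that \<open>p = inv v \<otimes> x\<close> is shortest. A
  reflection \<open>r\<close> of the subgroup in \<open>\<Phi> p\<close> would make
  \<open>r \<otimes> p\<close> shorter, and \<open>r \<otimes> p\<close> arises from
  \<open>v \<otimes> r\<close> in the same way.\<close>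

lemma parabolic_decomposition:
  assumes x: "x \<in> carrier W"
  obtains v p where "v \<in> parabolic J" "p \<in> carrier W" "x = v \<otimes> p"
    "\<Phi> p \<inter> parabolic_reflections J = {}" "\<Phi> x \<inter> parabolic_reflections J = \<Phi> v"
proof -
  obtain v where v: "v \<in> parabolic J"
    and least: "\<And>u. u \<in> parabolic J \<Longrightarrow> card (\<Phi> (inv v \<otimes> x)) \<le> card (\<Phi> (inv u \<otimes> x))"
    using ex_has_least_nat[of "\<lambda>v. v \<in> parabolic J" \<one> "\<lambda>v. card (\<Phi> (inv v \<otimes> x))"] one_parabolic
    by blast
  define p where "p = inv v \<otimes> x"
  have vc: "v \<in> carrier W" using v parabolic_closed by blast
  have p: "p \<in> carrier W" "x = v \<otimes> p" using x vc by (auto simp: p_def simp flip: m_assoc)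
  have disj: "\<Phi> p \<inter> parabolic_reflections J = {}"
  proof (rule ccontr)
    assume "\<Phi> p \<inter> parabolic_reflections J \<noteq> {}"
    then obtain r where r: "r \<in> \<Phi> p" "r \<in> parabolic_reflections J" by blast
    have rc: "r \<in> carrier W" using r parabolic_reflections_closed by blast
    have "inv r = r" using parabolic_reflections_square[OF r(2)] rc by (simp add: inv_equality)
    then have "inv (v \<otimes> r) \<otimes> x = r \<otimes> p"
      using rc vc x by (simp add: p_def inv_mult_group m_assoc)
    moreover have "v \<otimes> r \<in> parabolic J"
      using v r(2) mult_parabolic parabolic_reflections_parabolic by blast
    ultimately have "card (\<Phi> p) \<le> card (\<Phi> (r \<otimes> p))"
      using least[of "v \<otimes> r"] unfolding p_def by metis
    then show False using card_reflection_mult_less[OF p(1) r(1)] by linarith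
  qed
  have "r \<in> \<Phi> x \<longleftrightarrow> r \<in> \<Phi> v" if "r \<in> parabolic_reflections J" for r
    using mem_inversions_mult[of v p r] p vc parabolic_reflections_closed[OF that]
      conj_parabolic_reflections[OF inv_parabolic[OF v] that] disj by blast
  then have "\<Phi> x \<inter> parabolic_reflections J = \<Phi> v" using inversions_parabolic[OF v] by blast
  then show thesis using that v p disj by blast
qed

end

lemma right_descent_exists:
  assumes "u \<in> carrier W" "u \<noteq> \<one>"
  obtains x where "x \<in> S" "u \<rhd> x \<in> \<Phi> u"
proof -
  have "inv u \<in> parabolic S"
    using word_exists[of "inv u"] assms(1) unfolding parabolic_def by (metis imageI inv_closed)
  moreover have "inv u \<noteq> \<one>" using assms by simp
  ultimately obtain x where "x \<in> S" "x \<in> \<Phi> (inv u)"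
    using parabolic_descent_exists[of S "inv u"] by blast
  then show thesis using that right_descent_iff assms(1) by blast
qed

section \<open>The longest element of the subgroup generated by \<open>s\<close> and
  \<open>t\<close>\<close>

context
  fixes s t v J
  assumes st: "s \<in> S" "t \<in> S" and J: "J = {s, t}"
    and v: "v \<in> parabolic J" and desc: "s \<in> \<Phi> v" "t \<in> \<Phi> v"
begin

text \<open>Induction on the length, with \<open>u = u' x\<close> and \<open>u'\<close> below
  \<open>v\<close>. If \<open>v\<close> lacks the new inversion, a first step \<open>y\<close> from
  \<open>u'\<close> towards \<open>v\<close> differs from \<open>x\<close>, and neither letter is a
  right descent of \<open>u'\<close>. So \<open>u' = \<one>\<close>, and the missing inversion is
  the descent \<open>x\<close> of \<open>v\<close>.\<close>

lemma dihedral_short_le: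
  assumes "u \<in> parabolic J" "card (\<Phi> u) \<le> card (\<Phi> v)"
  shows "\<Phi> u \<subseteq> \<Phi> v"
  using assms
proof (induction "card (\<Phi> u)" arbitrary: u rule: less_induct)
  case less
  have JS: "J \<subseteq> S" using st J by simp
  have uc: "u \<in> carrier W" and vc: "v \<in> carrier W" using parabolic_closed[OF JS] less.prems v by auto
  show ?case
  proof (cases "u = \<one>")
    case False
    then have "inv u \<noteq> \<one>" using uc by simp
    then obtain x where x: "x \<in> J" "x \<in> \<Phi> (inv u)"
      using parabolic_descent_exists[OF JS inv_parabolic[OF JS less.prems(1)]] by blast
    have xS: "x \<in> S" "x \<in> carrier W" using x JS by auto
    define u' where "u' = u \<otimes> x"
    have u'c: "u' \<in> carrier W" and u'J: "u' \<in> parabolic J"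
      using uc xS mult_parabolic[OF JS less.prems(1) gen_parabolic[OF JS x(1)]] by (auto simp: u'_def)
    have ux: "u \<rhd> x \<in> \<Phi> u" using x uc xS right_descent_iff by blast
    then have \<Phi>u': "\<Phi> u' = \<Phi> u - {u \<rhd> x}"
      unfolding u'_def using inversions_mult_gen[OF uc xS(1)] by simp
    then have "card (\<Phi> u') < card (\<Phi> u)"
      using ux uc card_Diff1_less[of "\<Phi> u"] by simp
    then have le: "\<Phi> u' \<subseteq> \<Phi> v" and shorter: "card (\<Phi> u') < card (\<Phi> v)"
      using less.hyps[OF _ u'J] less.prems by auto
    have conj: "u' \<rhd> x = u \<rhd> x" using uc xS by (simp add: u'_def conj_by_mult)
    have "u \<rhd> x \<in> \<Phi> v"
    proof (rule ccontr)
      assume notin: "u \<rhd> x \<notin> \<Phi> v"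
      define v' where "v' = inv u' \<otimes> v"
      have "v' \<in> parabolic J"
        unfolding v'_def by (rule mult_parabolic[OF JS inv_parabolic[OF JS u'J] v])
      have "v' \<noteq> \<one>"
      proof
        assume "v' = \<one>"
        then have "u' = v" using inv_solve_left[of \<one> u' v] u'c vc by (simp add: v'_def)
        then show False using shorter by simp
      qed
      then obtain y where y: "y \<in> J" "y \<in> \<Phi> v'"
        using parabolic_descent_exists[OF JS \<open>v' \<in> parabolic J\<close>] by blast
      have yS: "y \<in> S" "y \<in> carrier W" using y JS by auto
      have mem: "r \<in> \<Phi> v' \<longleftrightarrow> (u' \<rhd> r \<in> \<Phi> u') \<noteq> (u' \<rhd> r \<in> \<Phi> v)" if "r \<in> carrier W" for r
        unfolding v'_def using mem_inversions_inv_mult[OF u'c vc that] .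
      have "x \<notin> \<Phi> v'" using mem[OF xS(2)] conj notin \<Phi>u' by auto
      then have "y \<noteq> x" using y by blast
      have "u' \<rhd> y \<notin> \<Phi> u'" using mem[OF yS(2)] y(2) le by blast
      then have "y \<notin> \<Phi> (inv u')" using right_descent_iff[OF u'c yS(1)] by simp
      moreover have "x \<notin> \<Phi> (inv u')"
        using right_descent_iff[OF u'c xS(1)] conj \<Phi>u' by simp
      moreover have "J = {x, y}" using J x y \<open>y \<noteq> x\<close> by auto
      ultimately have "inv u' = \<one>"
        using parabolic_descent_exists[OF JS inv_parabolic[OF JS u'J]] by blast
      then have "u' = \<one>" using u'c by simp
      then show False using conj notin desc x(1) J xS by auto
    qed
    then show ?thesis using \<Phi>u' le by blast
  qed simp
qed

text \<open>\<open>inv v\<close> lies in the subgroup and is as long as \<open>v\<close>, so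
  \<open>dihedral_short_le\<close> makes their inversion sets equal.\<close>

lemma dihedral_inv: "inv v = v"
proof -
  have JS: "J \<subseteq> S" using st J by simp
  have vc: "v \<in> carrier W" using parabolic_closed[OF JS v] .
  have "\<Phi> (inv v) \<subseteq> \<Phi> v"
    using dihedral_short_le[OF inv_parabolic[OF JS v]] card_inversions_inv[OF vc] by simp
  then have "\<Phi> (inv v) = \<Phi> v"
    using card_inversions_inv[OF vc] card_subset_eq[OF finite_inversions[OF vc]] by blast
  then show ?thesis using vc by (intro inversions_inject) auto
qed

text \<open>For a \<open>u\<close> longer than \<open>v\<close>, induction gives \<open>u x\<close>
  the length of \<open>v\<close>, hence \<open>u x = v\<close> by \<open>dihedral_short_le\<close>.
  But every \<open>x\<close> in \<open>J\<close> is a right descent of \<open>v = inv v\<close>, so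
  \<open>u = v x\<close> would be shorter than \<open>v\<close>.\<close>

lemma dihedral_le: "u \<in> parabolic J \<Longrightarrow> \<Phi> u \<subseteq> \<Phi> v"
proof -
  have JS: "J \<subseteq> S" using st J by simp
  have vc: "v \<in> carrier W" using parabolic_closed[OF JS v] .
  have "card (\<Phi> u) \<le> card (\<Phi> v)" if "u \<in> parabolic J" for u
    using that
  proof (induction "card (\<Phi> u)" arbitrary: u rule: less_induct)
    case less
    have uc: "u \<in> carrier W" using parabolic_closed[OF JS less.prems] .
    show ?case
    proof (rule ccontr)
      assume gt: "\<not> card (\<Phi> u) \<le> card (\<Phi> v)"
      then have "inv u \<noteq> \<one>" using uc by auto
      then obtain x where x: "x \<in> J" "x \<in> \<Phi> (inv u)"
        using parabolic_descent_exists[OF JS inv_parabolic[OF JS less.prems]] by blast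
      have xS: "x \<in> S" "x \<in> carrier W" using x JS by auto
      have u'J: "u \<otimes> x \<in> parabolic J"
        using mult_parabolic[OF JS less.prems gen_parabolic[OF JS x(1)]] .
      have ux: "u \<rhd> x \<in> \<Phi> u" using x uc xS right_descent_iff by blast
      then have \<Phi>u': "\<Phi> (u \<otimes> x) = \<Phi> u - {u \<rhd> x}"
        using inversions_mult_gen[OF uc xS(1)] by simp
      have card: "card (\<Phi> (u \<otimes> x)) < card (\<Phi> u)" "card (\<Phi> u) \<le> Suc (card (\<Phi> (u \<otimes> x)))"
        unfolding \<Phi>u' using ux uc card_Diff1_less[of "\<Phi> u"] card_Suc_Diff1[of "\<Phi> u"] by auto
      then have eq: "card (\<Phi> (u \<otimes> x)) = card (\<Phi> v)" using less.hyps[OF _ u'J] gt by linarith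
      then have "\<Phi> (u \<otimes> x) = \<Phi> v"
        using dihedral_short_le[OF u'J] card_subset_eq[OF finite_inversions[OF vc]] by auto
      then have "u \<otimes> x = v" using uc xS vc by (intro inversions_inject) auto
      then have "u \<rhd> x = v \<rhd> x" using uc xS by (auto simp: conj_by_mult)
      moreover have "v \<rhd> x \<in> \<Phi> v"
        using right_descent_iff[OF vc xS(1)] dihedral_inv desc x(1) J by auto
      ultimately show False using \<Phi>u' \<open>u \<otimes> x = v\<close> by auto
    qed
  qed
  then show "u \<in> parabolic J \<Longrightarrow> \<Phi> u \<subseteq> \<Phi> v" using dihedral_short_le by blast
qed

text \<open>If \<open>v \<rhd> x\<close> were outside \<open>J\<close>, then
  \<open>v \<otimes> x\<close> would keep both descents, so \<open>dihedral_le\<close> would hold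
  with it in place of \<open>v\<close>; but it has lost the inversion \<open>v \<rhd> x\<close> of
  \<open>v\<close>.\<close>

lemma dihedral_conj:
  assumes "x \<in> J" shows "v \<rhd> x \<in> J"
proof (rule ccontr)
  assume notin: "v \<rhd> x \<notin> J"
  have JS: "J \<subseteq> S" using st J by simp
  have vc: "v \<in> carrier W" using parabolic_closed[OF JS v] .
  have xS: "x \<in> S" using assms JS by auto
  have vx: "v \<rhd> x \<in> \<Phi> v" using right_descent_iff[OF vc xS] dihedral_inv desc assms J by auto
  then have \<Phi>: "\<Phi> (v \<otimes> x) = \<Phi> v - {v \<rhd> x}" using inversions_mult_gen[OF vc xS] by simp
  have "v \<otimes> x \<in> parabolic J" using mult_parabolic[OF JS v gen_parabolic[OF JS assms]] .
  moreover have "s \<in> \<Phi> (v \<otimes> x)" "t \<in> \<Phi> (v \<otimes> x)" using notin \<Phi> desc J by auto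
  ultimately have "\<Phi> v \<subseteq> \<Phi> (v \<otimes> x)"
    using coxeter_group.dihedral_le[OF coxeter_group_axioms st J _ _ _ v] by blast
  then show False using vx \<Phi> by blast
qed

text \<open>A reflection of the subgroup is an inversion of itself and, as an element of the
  subgroup, lies below \<open>v\<close>.\<close>

lemma dihedral_inversions: "\<Phi> v = parabolic_reflections J"
proof
  have JS: "J \<subseteq> S" using st J by simp
  show "\<Phi> v \<subseteq> parabolic_reflections J" by (rule inversions_parabolic[OF JS v])
  show "parabolic_reflections J \<subseteq> \<Phi> v"
  proof
    fix r assume r: "r \<in> parabolic_reflections J"
    then obtain m x where m: "m \<in> parabolic J" "x \<in> J" "r = m \<rhd> x"
      unfolding parabolic_reflections_def by blast
    then have c: "m \<in> carrier W" "x \<in> S" "r \<in> carrier W"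
      using parabolic_closed[OF JS] JS parabolic_reflections_closed[OF JS r] by auto
    have "r \<rhd> r = r"
      using c parabolic_reflections_square[OF JS r] by (simp add: conj_by_def inv_equality)
    then have "r \<in> \<Phi> r" using mem_inversions_conj[OF c] m(3) by auto
    then show "r \<in> \<Phi> v" using dihedral_le[OF parabolic_reflections_parabolic[OF JS r]] by blast
  qed
qed

end

text \<open>
  Here \<open>m\<close> is the shortest element of the coset of \<open>z\<close> modulo the subgroup generated by \<open>s\<close> and
  \<open>t\<close>, and \<open>R\<close> is the set of the reflections that fix this coset.
\<close>

definition residue :: "'a \<Rightarrow> 'a \<Rightarrow> 'a \<Rightarrow> 'a \<Rightarrow> 'a set \<Rightarrow> bool" where
  "residue z s t m R \<longleftrightarrow>
     z \<in> carrier W \<and> s \<in> S \<and> t \<in> S \<and> m \<in> carrier W \<and> z \<rhd> s \<noteq> z \<rhd> t \<and>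
     \<Phi> z = \<Phi> m \<union> R \<and> \<Phi> m \<inter> R = {} \<and> z \<rhd> s \<in> R \<and> z \<rhd> t \<in> R \<and>
     (\<exists>s'\<in>S. z \<rhd> s = m \<rhd> s') \<and> (\<exists>t'\<in>S. z \<rhd> t = m \<rhd> t') \<and>
     (\<forall>r\<in>R. (z \<rhd> s) \<rhd> r \<in> R) \<and> (\<forall>r\<in>R. (z \<rhd> t) \<rhd> r \<in> R) \<and>
     (\<forall>y\<in>carrier W. \<Phi> y \<inter> R \<noteq> {} \<longrightarrow> z \<rhd> s \<in> \<Phi> y \<or> z \<rhd> t \<in> \<Phi> y)"

lemma residue_sym: "residue z s t m R \<Longrightarrow> residue z t s m R"
  unfolding residue_def by metis

text \<open>Split \<open>inv z\<close> as \<open>v \<otimes> p\<close> with \<open>v\<close> in the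
  subgroup of \<open>s\<close> and \<open>t\<close>. Both generators are descents of
  \<open>v\<close>, so \<open>v\<close> is the longest element and its own inverse. Hence
  \<open>z = m \<otimes> v\<close> with \<open>m = inv p\<close>, and \<open>R\<close> consists of
  the reflections of the subgroup conjugated by \<open>m\<close>.\<close>

lemma residue_exists:
  assumes z: "z \<in> carrier W" and st: "s \<in> S" "t \<in> S" "s \<noteq> t"
    and desc: "z \<rhd> s \<in> \<Phi> z" "z \<rhd> t \<in> \<Phi> z"
  obtains m R where "residue z s t m R"
proof -
  define J where "J = {s, t}"
  have JS: "J \<subseteq> S" using st by (simp add: J_def)
  let ?T = "parabolic_reflections J"
  have izc: "inv z \<in> carrier W" using z by simp
  obtain v p where v: "v \<in> parabolic J" and p: "p \<in> carrier W" "inv z = v \<otimes> p"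
    "\<Phi> p \<inter> ?T = {}" "\<Phi> (inv z) \<inter> ?T = \<Phi> v"
    by (rule parabolic_decomposition[OF JS izc])
  have vc: "v \<in> carrier W" using parabolic_closed[OF JS v] .
  have "s \<in> \<Phi> (inv z)" "t \<in> \<Phi> (inv z)" using desc right_descent_iff[OF z] st by auto
  then have dv: "s \<in> \<Phi> v" "t \<in> \<Phi> v"
    using p(4) gen_parabolic_reflections[OF JS] J_def by auto
  note D = st(1,2) J_def v dv
  have iv: "inv v = v" by (rule dihedral_inv[OF D])
  have \<Phi>v: "\<Phi> v = ?T" by (rule dihedral_inversions[OF D])
  define m where "m = inv p"
  have mc: "m \<in> carrier W" and im: "inv m = p" using p by (auto simp: m_def)
  have zm: "z = m \<otimes> v"
  proof -
    have "z = inv (inv z)" using z by simp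
    also have "\<dots> = m \<otimes> v" using p vc iv by (simp add: m_def inv_mult_group)
    finally show ?thesis .
  qed
  define R where "R = (\<rhd>) m ` ?T"
  have Tc: "r \<in> carrier W" if "r \<in> ?T" for r using parabolic_reflections_closed[OF JS that] .
  have R_iff: "r \<in> R \<longleftrightarrow> inv m \<rhd> r \<in> ?T" if "r \<in> carrier W" for r
  proof
    assume "r \<in> R"
    then obtain q where "q \<in> ?T" "r = m \<rhd> q" unfolding R_def by blast
    then show "inv m \<rhd> r \<in> ?T" using Tc mc by simp
  next
    assume *: "inv m \<rhd> r \<in> ?T"
    have "r = m \<rhd> inv m \<rhd> r" using that mc by simp
    then show "r \<in> R" unfolding R_def using * by blast
  qed
  have Rc: "R \<subseteq> carrier W" unfolding R_def using Tc mc by auto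
  have disj: "\<Phi> m \<inter> R = {}"
  proof -
    have "m \<rhd> r \<notin> \<Phi> m" if "r \<in> ?T" for r
      using mem_inversions_inv[OF mc Tc[OF that]] im p(3) that by auto
    then show ?thesis unfolding R_def by auto
  qed
  have \<Phi>z: "\<Phi> z = \<Phi> m \<union> R"
  proof -
    have "r \<in> \<Phi> z \<longleftrightarrow> r \<in> \<Phi> m \<union> R" if "r \<in> carrier W" for r
      using mem_inversions_mult[OF mc vc that] R_iff[OF that] disj \<Phi>v zm by auto
    then show ?thesis using inversions_closed Rc by blast
  qed
  have vs: "v \<rhd> x \<in> J" if "x \<in> J" for x using dihedral_conj[OF D that] .
  have zx: "z \<rhd> x = m \<rhd> v \<rhd> x" if "x \<in> J" for x
    using that JS mc vc zm by (auto simp: conj_by_mult)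
  have JR: "m \<rhd> x \<in> R" if "x \<in> J" for x
    unfolding R_def using gen_parabolic_reflections[OF JS that] by blast
  have conjR: "(m \<rhd> x) \<rhd> r \<in> R" if "x \<in> J" "r \<in> R" for x r
  proof -
    have c: "x \<in> carrier W" "r \<in> carrier W" using that JS Rc by auto
    have "inv m \<rhd> (m \<rhd> x) \<rhd> r = x \<rhd> inv m \<rhd> r"
      using c mc by (simp add: conj_by_def[of m x] conj_by_mult)
    then show ?thesis
      using R_iff[of "(m \<rhd> x) \<rhd> r"] R_iff[OF c(2)] that c mc
        conj_parabolic_reflections[OF JS gen_parabolic[OF JS that(1)]] by simp
  qed
  \<comment> \<open>Seen from \<open>m\<close>, an element that crosses a wall of the residue has a
    nontrivial part \<open>u\<close> in the subgroup. A descent \<open>x\<close> of \<open>u\<close>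
    gives the crossed wall \<open>m \<rhd> x\<close>, which is \<open>z \<rhd> v \<rhd> x\<close>
    with \<open>v \<rhd> x\<close> in \<open>J\<close>.\<close>
  have meet: "z \<rhd> s \<in> \<Phi> y \<or> z \<rhd> t \<in> \<Phi> y" if y: "y \<in> carrier W" and meets: "\<Phi> y \<inter> R \<noteq> {}" for y
  proof -
    obtain q where q: "q \<in> ?T" "m \<rhd> q \<in> \<Phi> y" using meets unfolding R_def by blast
    have mem: "r \<in> \<Phi> (inv m \<otimes> y) \<longleftrightarrow> m \<rhd> r \<in> \<Phi> y" if "r \<in> ?T" for r
      using mem_inversions_inv_mult[OF mc y Tc[OF that]] disj that unfolding R_def by auto
    obtain u p' where u: "u \<in> parabolic J" "\<Phi> (inv m \<otimes> y) \<inter> ?T = \<Phi> u"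
      using parabolic_decomposition[OF JS, of "inv m \<otimes> y"] mc y by (metis inv_closed m_closed)
    have "q \<in> \<Phi> u" using mem[OF q(1)] q u(2) by blast
    then have "u \<noteq> \<one>" by auto
    then obtain x where x: "x \<in> J" "x \<in> \<Phi> u" using parabolic_descent_exists[OF JS u(1)] by blast
    have xc: "x \<in> carrier W" using x JS by auto
    have "m \<rhd> x \<in> \<Phi> y" using x u(2) mem[OF gen_parabolic_reflections[OF JS x(1)]] by blast
    moreover have "m \<rhd> x = z \<rhd> v \<rhd> x"
    proof -
      have "v \<rhd> v \<rhd> x = x" using conj_by_inv(1)[OF vc xc] iv by simp
      then show ?thesis using zx[OF vs[OF x(1)]] by simp
    qed
    ultimately show ?thesis using vs[OF x(1)] by (auto simp: J_def)
  qed
  have sJ: "s \<in> J" "t \<in> J" by (auto simp: J_def)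
  have "residue z s t m R"
    unfolding residue_def
  proof (intro conjI)
    show "\<exists>s'\<in>S. z \<rhd> s = m \<rhd> s'" "\<exists>t'\<in>S. z \<rhd> t = m \<rhd> t'" using zx vs sJ JS by blast+
    show "z \<rhd> s \<in> R" "z \<rhd> t \<in> R" using zx JR vs sJ by auto
    show "\<forall>r\<in>R. (z \<rhd> s) \<rhd> r \<in> R" "\<forall>r\<in>R. (z \<rhd> t) \<rhd> r \<in> R"
      using zx conjR vs sJ by auto
    show "z \<rhd> s \<noteq> z \<rhd> t" using conj_by_inject[of z s t] z st gen_closed by blast
  qed (use z st mc \<Phi>z disj meet in auto)
  then show thesis by (rule that)
qed

section \<open>Least elements of convex sets\<close>

text \<open>A right descent \<open>s\<close> of \<open>inv g \<otimes> u\<close> is the last edge of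
  a geodesic from \<open>g\<close> to \<open>u\<close>, and the wall of that edge separates the
  two.\<close>

lemma step_towards:
  assumes "g \<in> carrier W" "u \<in> carrier W" "g \<noteq> u"
  obtains s where "s \<in> S" "(u \<rhd> s \<in> \<Phi> g) \<noteq> (u \<rhd> s \<in> \<Phi> u)"
proof -
  have "inv g \<otimes> u \<noteq> \<one>" using assms inv_solve_left[of \<one> g u] by auto
  then obtain s where s: "s \<in> S" "(inv g \<otimes> u) \<rhd> s \<in> \<Phi> (inv g \<otimes> u)"
    using right_descent_exists[of "inv g \<otimes> u"] assms by (metis inv_closed m_closed)
  have "g \<rhd> (inv g \<otimes> u) \<rhd> s = u \<rhd> s"
    using assms(1,2) s(1) by (simp add: conj_by_mult)
  then show thesis
    using that[OF s(1)] s(2) mem_inversions_inv_mult[OF assms(1,2), of "(inv g \<otimes> u) \<rhd> s"]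
      assms(1,2) s(1) by simp
qed

lemma step_down:
  assumes "a \<in> carrier W" "z \<in> carrier W" "\<Phi> a \<subseteq> \<Phi> z" "a \<noteq> z"
  obtains s where "s \<in> S" "z \<rhd> s \<in> \<Phi> z" "\<Phi> (z \<otimes> s) = \<Phi> z - {z \<rhd> s}" "\<Phi> a \<subseteq> \<Phi> (z \<otimes> s)"
proof -
  obtain s where s: "s \<in> S" "(z \<rhd> s \<in> \<Phi> a) \<noteq> (z \<rhd> s \<in> \<Phi> z)"
    using step_towards[OF assms(1,2,4)] by blast
  then have "z \<rhd> s \<in> \<Phi> z" "z \<rhd> s \<notin> \<Phi> a" using assms(3) by auto
  then show thesis using that[OF s(1)] inversions_mult_gen[OF assms(2) s(1)] assms(3) by auto
qed

text \<open>The two inclusions say that no reflection separates \<open>b\<close> from both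
  \<open>x\<close> and \<open>y\<close>, that is, \<open>b\<close> lies on a geodesic of the Cayley
  graph from \<open>x\<close> to \<open>y\<close>.\<close>

definition geodesically_convex :: "'a set \<Rightarrow> bool" where
  "geodesically_convex U \<longleftrightarrow>
     (\<forall>x\<in>U. \<forall>y\<in>U. \<forall>b\<in>carrier W. \<Phi> x \<inter> \<Phi> y \<subseteq> \<Phi> b \<and> \<Phi> b \<subseteq> \<Phi> x \<union> \<Phi> y \<longrightarrow> b \<in> U)"

lemma geodesically_convexD:
  "\<lbrakk>geodesically_convex U; x \<in> U; y \<in> U; b \<in> carrier W; \<Phi> x \<inter> \<Phi> y \<subseteq> \<Phi> b; \<Phi> b \<subseteq> \<Phi> x \<union> \<Phi> y\<rbrakk>
    \<Longrightarrow> b \<in> U"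
  unfolding geodesically_convex_def by blast

lemma residue_le:
  assumes "residue z s t m R"
  shows "\<Phi> (z \<otimes> s) = \<Phi> z - {z \<rhd> s}" "\<Phi> m \<subseteq> \<Phi> (z \<otimes> s)"
    "card (\<Phi> (z \<otimes> s)) < card (\<Phi> z)" "z \<otimes> s \<in> carrier W"
proof -
  have z: "z \<in> carrier W" "s \<in> S" "z \<rhd> s \<in> \<Phi> z" using assms unfolding residue_def by auto
  then show *: "\<Phi> (z \<otimes> s) = \<Phi> z - {z \<rhd> s}" using inversions_mult_gen by simp
  then show "\<Phi> m \<subseteq> \<Phi> (z \<otimes> s)" using assms unfolding residue_def by blast
  show "card (\<Phi> (z \<otimes> s)) < card (\<Phi> z)" using * z card_Diff1_less[of "\<Phi> z"] by simp
  show "z \<otimes> s \<in> carrier W" using z by auto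
qed

text \<open>
  Newman's lemma for descents inside \<open>U\<close>: the peak condition is local confluence, and
  convexity makes \<open>U\<close> connected.
\<close>

lemma convex_peak_closed_least:
  assumes U: "U \<subseteq> carrier W" "U \<noteq> {}" "geodesically_convex U"
    and peak: "\<And>z s t m R. \<lbrakk>residue z s t m R; z \<in> U; z \<otimes> s \<in> U; z \<otimes> t \<in> U\<rbrakk> \<Longrightarrow> m \<in> U"
  shows "\<exists>g\<in>U. \<forall>u\<in>U. \<Phi> g \<subseteq> \<Phi> u"
proof -
  define local_min where
    "local_min n \<longleftrightarrow> n \<in> U \<and> (\<forall>s\<in>S. n \<rhd> s \<in> \<Phi> n \<longrightarrow> n \<otimes> s \<notin> U)" for n
  have local_min_below: "\<exists>n. local_min n \<and> \<Phi> n \<subseteq> \<Phi> z" if zU: "z \<in> U" for z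
  proof -
    obtain n where n: "n \<in> U \<and> \<Phi> n \<subseteq> \<Phi> z"
      and least: "\<And>k. k \<in> U \<and> \<Phi> k \<subseteq> \<Phi> z \<Longrightarrow> card (\<Phi> n) \<le> card (\<Phi> k)"
      using ex_has_least_nat[of "\<lambda>n. n \<in> U \<and> \<Phi> n \<subseteq> \<Phi> z" z "\<lambda>n. card (\<Phi> n)"] zU by blast
    have nc: "n \<in> carrier W" using n U by blast
    have "n \<otimes> s \<notin> U" if s: "s \<in> S" "n \<rhd> s \<in> \<Phi> n" for s
    proof
      assume "n \<otimes> s \<in> U"
      moreover have \<Phi>: "\<Phi> (n \<otimes> s) = \<Phi> n - {n \<rhd> s}" using inversions_mult_gen[OF nc s(1)] s by simp
      ultimately have "card (\<Phi> n) \<le> card (\<Phi> n - {n \<rhd> s})" using least[of "n \<otimes> s"] n by auto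
      then show False using s card_Diff1_less[of "\<Phi> n"] nc by fastforce
    qed
    then show ?thesis using n unfolding local_min_def by blast
  qed
  \<comment> \<open>Induction on the length of \<open>z\<close>. In the main case the two local
    minima lie below different neighbours \<open>z s\<close> and \<open>z t\<close>; a local minimum
    below the bottom \<open>m\<close> of the residue lies below both neighbours and so equals each
    of the two.\<close>
  have unique: "n = n'"
    if "z \<in> U" "local_min n" "local_min n'" "\<Phi> n \<subseteq> \<Phi> z" "\<Phi> n' \<subseteq> \<Phi> z" for z n n'
    using that
  proof (induction "card (\<Phi> z)" arbitrary: z n n' rule: less_induct)
    case less
    have c: "z \<in> carrier W" "n \<in> carrier W" "n' \<in> carrier W" "n \<in> U" "n' \<in> U"
      using less.prems U local_min_def by auto
    have interval: "b \<in> U" if "x \<in> U" "b \<in> carrier W" "\<Phi> x \<subseteq> \<Phi> b" "\<Phi> b \<subseteq> \<Phi> y" "y \<in> U" for x b y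
      using geodesically_convexD[OF U(3) that(1,5,2)] that by blast
    \<comment> \<open>If \<open>z\<close> is itself a local minimum, convexity leaves no other
      element of \<open>U\<close> below it.\<close>
    have top: "k = z" if k: "local_min z" "k \<in> U" "\<Phi> k \<subseteq> \<Phi> z" for k
    proof (rule ccontr)
      assume "k \<noteq> z"
      then obtain s where s: "s \<in> S" "z \<rhd> s \<in> \<Phi> z" "\<Phi> (z \<otimes> s) = \<Phi> z - {z \<rhd> s}" "\<Phi> k \<subseteq> \<Phi> (z \<otimes> s)"
        using step_down[of k z] k U c by blast
      have "z \<otimes> s \<in> U" using interval[OF k(2), of "z \<otimes> s" z] s c less.prems(1) by auto
      then show False using k(1) s unfolding local_min_def by blast
    qed
    show ?case
    proof (cases "n = z \<or> n' = z")
      case True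
      then show ?thesis using top less.prems c by metis
    next
      case False
      obtain s where s: "s \<in> S" "z \<rhd> s \<in> \<Phi> z" "\<Phi> (z \<otimes> s) = \<Phi> z - {z \<rhd> s}" "\<Phi> n \<subseteq> \<Phi> (z \<otimes> s)"
        using step_down[of n z] less.prems(4) c False by blast
      obtain t where t: "t \<in> S" "z \<rhd> t \<in> \<Phi> z" "\<Phi> (z \<otimes> t) = \<Phi> z - {z \<rhd> t}" "\<Phi> n' \<subseteq> \<Phi> (z \<otimes> t)"
        using step_down[of n' z] less.prems(5) c False by blast
      have zs: "z \<otimes> s \<in> U" using interval[OF c(4), of "z \<otimes> s" z] s c less.prems(1) by auto
      have zt: "z \<otimes> t \<in> U" using interval[OF c(5), of "z \<otimes> t" z] t c less.prems(1) by auto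
      have ls: "card (\<Phi> (z \<otimes> s)) < card (\<Phi> z)" "card (\<Phi> (z \<otimes> t)) < card (\<Phi> z)"
        using s t c card_Diff1_less[of "\<Phi> z"] by auto
      show ?thesis
      proof (cases "s = t")
        case True
        then show ?thesis using less.hyps[OF ls(1) zs less.prems(2,3)] s t by blast
      next
        case False
        obtain m R where res: "residue z s t m R"
          using residue_exists[OF c(1) s(1) t(1) False s(2) t(2)] .
        have "m \<in> U" using peak[OF res less.prems(1) zs zt] .
        then obtain k where k: "local_min k" "\<Phi> k \<subseteq> \<Phi> m" using local_min_below by blast
        have "\<Phi> k \<subseteq> \<Phi> (z \<otimes> s)" "\<Phi> k \<subseteq> \<Phi> (z \<otimes> t)"
          using k(2) residue_le(2)[OF res] residue_le(2)[OF residue_sym[OF res]] by auto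
        then have "n = k" "n' = k"
          using less.hyps[OF ls(1) zs less.prems(2) k(1) s(4)]
            less.hyps[OF ls(2) zt less.prems(3) k(1) t(4)] by auto
        then show ?thesis by simp
      qed
    qed
  qed
  obtain g where g: "local_min g" using local_min_below U(2) by blast
  then have gU: "g \<in> U" and gc: "g \<in> carrier W" using U local_min_def by auto
  \<comment> \<open>Induction on the distance from \<open>g\<close>: by convexity the step from
    \<open>u\<close> towards \<open>g\<close> stays in \<open>U\<close>.\<close>
  have "\<Phi> g \<subseteq> \<Phi> u" if "u \<in> U" for u
    using that
  proof (induction "card ((\<Phi> g - \<Phi> u) \<union> (\<Phi> u - \<Phi> g))" arbitrary: u rule: less_induct)
    case less
    have uc: "u \<in> carrier W" using less.prems U by blast
    show ?case
    proof (cases "g = u")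
      case False
      then obtain s where s: "s \<in> S" "(u \<rhd> s \<in> \<Phi> g) \<noteq> (u \<rhd> s \<in> \<Phi> u)"
        using step_towards[OF gc uc] by blast
      let ?u = "u \<otimes> s"
      have \<Phi>: "\<Phi> ?u = (if u \<rhd> s \<in> \<Phi> u then \<Phi> u - {u \<rhd> s} else insert (u \<rhd> s) (\<Phi> u))"
        using inversions_mult_gen[OF uc s(1)] .
      have u': "?u \<in> carrier W" using uc s by auto
      have U': "?u \<in> U"
        by (rule geodesically_convexD[OF U(3) gU less.prems u'])
          (use s \<Phi> in \<open>auto split: if_splits\<close>)
      have "(\<Phi> g - \<Phi> ?u) \<union> (\<Phi> ?u - \<Phi> g) \<subset> (\<Phi> g - \<Phi> u) \<union> (\<Phi> u - \<Phi> g)"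
        using s(2) \<Phi> by (auto split: if_splits)
      then have "card ((\<Phi> g - \<Phi> ?u) \<union> (\<Phi> ?u - \<Phi> g)) < card ((\<Phi> g - \<Phi> u) \<union> (\<Phi> u - \<Phi> g))"
        using gc uc by (intro psubset_card_mono) auto
      then have le: "\<Phi> g \<subseteq> \<Phi> ?u" using less.hyps U' by blast
      show ?thesis
      proof (cases "u \<rhd> s \<in> \<Phi> u")
        case True
        then show ?thesis using le \<Phi> by auto
      next
        case False
        \<comment> \<open>The step went up. A local minimum below \<open>u\<close> is also below
          \<open>u \<otimes> s\<close>, as \<open>g\<close> is, so it equals
          \<open>g\<close>.\<close>
        obtain n where n: "local_min n" "\<Phi> n \<subseteq> \<Phi> u" using local_min_below[OF less.prems] by blast
        then have "\<Phi> n \<subseteq> \<Phi> ?u" using \<Phi> False by auto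
        then show ?thesis using unique[OF U' n(1) g _ le] n(2) by simp
      qed
    qed simp
  qed
  then show ?thesis using gU by blast
qed

text \<open>The upper bounds of \<open>X\<close> form a convex set. It meets the peak condition: an
  \<open>x\<close> below \<open>z s\<close> and \<open>z t\<close> misses the walls
  \<open>z \<rhd> s\<close> and \<open>z \<rhd> t\<close>, hence all of \<open>R\<close> by the last
  clause of \<open>residue\<close>, and so lies below \<open>m\<close>.\<close>

lemma join_exists:
  assumes "X \<subseteq> carrier W" "b \<in> carrier W" "\<And>x. x \<in> X \<Longrightarrow> \<Phi> x \<subseteq> \<Phi> b"
  obtains j where "j \<in> carrier W" "\<And>x. x \<in> X \<Longrightarrow> \<Phi> x \<subseteq> \<Phi> j"
    "\<And>u. u \<in> carrier W \<Longrightarrow> (\<And>x. x \<in> X \<Longrightarrow> \<Phi> x \<subseteq> \<Phi> u) \<Longrightarrow> \<Phi> j \<subseteq> \<Phi> u"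
proof -
  define U where "U = {u \<in> carrier W. \<forall>x\<in>X. \<Phi> x \<subseteq> \<Phi> u}"
  have "geodesically_convex U"
    unfolding geodesically_convex_def U_def by blast
  moreover have "U \<noteq> {}" "U \<subseteq> carrier W" using assms unfolding U_def by auto
  moreover have "m \<in> U"
    if res: "residue z s t m R" and zU: "z \<otimes> s \<in> U" "z \<otimes> t \<in> U" for z s t m R
  proof -
    have "\<Phi> x \<subseteq> \<Phi> m" if x: "x \<in> X" for x
    proof -
      have "\<Phi> x \<subseteq> \<Phi> (z \<otimes> s)" "\<Phi> x \<subseteq> \<Phi> (z \<otimes> t)" using zU x unfolding U_def by auto
      then have *: "\<Phi> x \<subseteq> \<Phi> z" "z \<rhd> s \<notin> \<Phi> x" "z \<rhd> t \<notin> \<Phi> x"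
        using residue_le(1)[OF res] residue_le(1)[OF residue_sym[OF res]] by auto
      then have "\<Phi> x \<inter> R = {}" using res x assms(1) unfolding residue_def by blast
      then show ?thesis using *(1) res unfolding residue_def by blast
    qed
    then show ?thesis using res unfolding U_def residue_def by blast
  qed
  ultimately obtain j where "j \<in> U" "\<forall>u\<in>U. \<Phi> j \<subseteq> \<Phi> u"
    using convex_peak_closed_least[of U] by blast
  then show thesis using that[of j] unfolding U_def by simp
qed

section \<open>Cone types and gates\<close>

text \<open>By \<open>cone_type_inv\<close> below, \<open>cone w\<close> is the cone type of \<open>inv w\<close>.\<close>

definition cone :: "'a \<Rightarrow> 'a set" where
  "cone w = {y \<in> carrier W. \<Phi> y \<inter> \<Phi> w = {}}"

text \<open>The cone type is the one that \<open>g\<close> itself gives; \<open>gates_eq\<close>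
  identifies these elements with \<open>gates\<close>.\<close>

definition is_gate :: "'a \<Rightarrow> bool" where
  "is_gate g \<longleftrightarrow> g \<in> carrier W \<and> (\<forall>w\<in>carrier W. cone w = cone g \<longrightarrow> \<Phi> g \<subseteq> \<Phi> w)"

text \<open>The length of \<open>inv w \<otimes> y\<close> is the size of the symmetric difference
  of \<open>\<Phi> w\<close> and \<open>\<Phi> y\<close>, so lengths add exactly when the two sets
  are disjoint.\<close>

lemma cone_type_inv:
  assumes "w \<in> carrier W" shows "cone_type W S (inv w) = cone w"
proof -
  have "len W S (inv w \<otimes> y) = len W S (inv w) + len W S y \<longleftrightarrow> \<Phi> y \<inter> \<Phi> w = {}"
    if y: "y \<in> carrier W" for y
  proof -
    have f: "finite (\<Phi> w)" "finite (\<Phi> y)" using assms y by auto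
    have "card ((\<Phi> w - \<Phi> y) \<union> (\<Phi> y - \<Phi> w)) = card (\<Phi> w - \<Phi> y) + card (\<Phi> y - \<Phi> w)"
      using f by (intro card_Un_disjoint) auto
    moreover have "card (\<Phi> w) = card (\<Phi> w - \<Phi> y) + card (\<Phi> y \<inter> \<Phi> w)"
      using f card_Int_Diff[of "\<Phi> w" "\<Phi> y"] by (simp add: Int_commute)
    moreover have "card (\<Phi> y) = card (\<Phi> y - \<Phi> w) + card (\<Phi> y \<inter> \<Phi> w)"
      using f card_Int_Diff[of "\<Phi> y" "\<Phi> w"] by simp
    moreover have "card (\<Phi> y \<inter> \<Phi> w) = 0 \<longleftrightarrow> \<Phi> y \<inter> \<Phi> w = {}" using f by simp
    ultimately show ?thesis
      using assms y by (simp only: len_eq_card card_inversions_inv_mult card_inversions_inv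
          inv_closed m_closed) linarith
  qed
  then show ?thesis unfolding cone_type_def cone_def by auto
qed

lemma cone_antimono: "\<Phi> x \<subseteq> \<Phi> y \<Longrightarrow> cone y \<subseteq> cone x"
  unfolding cone_def by blast

text \<open>A shortest element below \<open>p\<close> that still meets \<open>\<Phi> x\<close> stops
  meeting it when its last letter is removed, so the two share one reflection \<open>r\<close>.
  Cones thus detect \<open>r\<close>: \<open>q'\<close> is in the cone of \<open>x\<close> and
  \<open>q\<close> is not.\<close>

lemma minimal_meet:
  assumes p: "p \<in> carrier W" "\<Phi> p \<inter> \<Phi> x \<noteq> {}"
  obtains q r where "q \<in> carrier W" "\<Phi> q \<subseteq> \<Phi> p" "\<Phi> q \<inter> \<Phi> x = {r}"
    "\<exists>q'\<in>carrier W. \<Phi> q' = \<Phi> q - {r}"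
proof -
  let ?P = "\<lambda>q. q \<in> carrier W \<and> \<Phi> q \<subseteq> \<Phi> p \<and> \<Phi> q \<inter> \<Phi> x \<noteq> {}"
  have "?P p" using p by simp
  from ex_has_least_nat[of ?P, OF this, of "\<lambda>q. card (\<Phi> q)"]
  obtain q where q: "?P q" and least: "\<And>k. ?P k \<Longrightarrow> card (\<Phi> q) \<le> card (\<Phi> k)" by blast
  have qc: "q \<in> carrier W" using q by blast
  have "q \<noteq> \<one>" using q by auto
  then obtain s where s: "s \<in> S" "q \<rhd> s \<in> \<Phi> q" using right_descent_exists[OF qc] by blast
  have \<Phi>: "\<Phi> (q \<otimes> s) = \<Phi> q - {q \<rhd> s}" using inversions_mult_gen[OF qc s(1)] s(2) by simp
  have "card (\<Phi> (q \<otimes> s)) < card (\<Phi> q)" using \<Phi> s(2) qc card_Diff1_less[of "\<Phi> q"] by simp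
  then have "\<not> ?P (q \<otimes> s)" using least[of "q \<otimes> s"] by linarith
  moreover have c: "q \<otimes> s \<in> carrier W" using qc s(1) by simp
  ultimately have "\<Phi> q \<inter> \<Phi> x = {q \<rhd> s}" using \<Phi> q by blast
  then show thesis using that[OF qc] q \<Phi> c by blast
qed

text \<open>The inclusion \<open>cone b \<subseteq> T\<close> is the one that needs an idea. If
  \<open>p\<close> misses \<open>\<Phi> b\<close> but meets \<open>\<Phi> x\<close>,
  \<open>minimal_meet\<close> gives \<open>q\<close> and \<open>r\<close>; as \<open>x\<close> and
  \<open>y\<close> have the same cone, \<open>r\<close> is in \<open>\<Phi> y\<close> too, hence in
  \<open>\<Phi> b\<close>, although it is an inversion of \<open>p\<close>.\<close>

lemma convex_cone_class: "geodesically_convex {w \<in> carrier W. cone w = T}"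
  unfolding geodesically_convex_def
proof (intro ballI impI)
  fix x y b
  assume x: "x \<in> {w \<in> carrier W. cone w = T}" and y: "y \<in> {w \<in> carrier W. cone w = T}"
    and b: "b \<in> carrier W" "\<Phi> x \<inter> \<Phi> y \<subseteq> \<Phi> b \<and> \<Phi> b \<subseteq> \<Phi> x \<union> \<Phi> y"
  have "T \<subseteq> cone b" using x y b unfolding cone_def by blast
  moreover have "p \<in> T" if p: "p \<in> cone b" for p
  proof (rule ccontr)
    assume "p \<notin> T"
    then have "p \<in> carrier W" "\<Phi> p \<inter> \<Phi> x \<noteq> {}" using p x unfolding cone_def by auto
    then obtain q r q' where q: "q \<in> carrier W" "\<Phi> q \<subseteq> \<Phi> p" "\<Phi> q \<inter> \<Phi> x = {r}"
      and q': "q' \<in> carrier W" "\<Phi> q' = \<Phi> q - {r}"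
      by (rule minimal_meet) blast
    have "q' \<in> cone x" "q \<notin> cone x" using q q' unfolding cone_def by auto
    then have "q' \<in> cone y" "q \<notin> cone y" using x y by auto
    then have "r \<in> \<Phi> y" using q q' unfolding cone_def by auto
    then have "r \<in> \<Phi> b" using q(3) b(2) by blast
    then show False using p q(2,3) unfolding cone_def by blast
  qed
  ultimately show "b \<in> {w \<in> carrier W. cone w = T}" using b by blast
qed

text \<open>Write \<open>q = m \<rhd> s\<close>. Then \<open>inv m \<otimes> (q \<otimes> y) = s
  \<otimes> (inv m \<otimes> y)\<close> is one shorter than the lengths of \<open>m\<close> and
  \<open>y\<close> together. As \<open>q \<otimes> y\<close> is shorter than \<open>y\<close>, an
  inversion common to it and \<open>m\<close> would make the left side shorter still.\<close>

lemma reflection_cone: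
  assumes "m \<in> carrier W" "s \<in> S" "m \<rhd> s \<notin> \<Phi> m" "y \<in> cone m" "m \<rhd> s \<in> \<Phi> y"
  shows "(m \<rhd> s) \<otimes> y \<in> cone m" "card (\<Phi> ((m \<rhd> s) \<otimes> y)) < card (\<Phi> y)"
proof -
  have y: "y \<in> carrier W" "\<Phi> y \<inter> \<Phi> m = {}" using assms unfolding cone_def by auto
  have s: "s \<in> carrier W" using assms by blast
  let ?q = "m \<rhd> s"
  let ?x = "inv m \<otimes> y"
  have qc: "?q \<in> carrier W" using assms s by simp
  have "s \<in> \<Phi> ?x" using mem_inversions_inv_mult[of m y s] assms(1,3,5) s y by simp
  then have "\<Phi> (s \<otimes> ?x) = (\<rhd>) s ` (\<Phi> ?x - {s})"
    using inversions_gen_mult(2) assms y by simp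
  moreover have "inj_on ((\<rhd>) s) (carrier W)" using s by (auto intro: inj_onI)
  then have "inj_on ((\<rhd>) s) (\<Phi> ?x - {s})"
    by (rule inj_on_subset) (use inversions_subset in blast)
  ultimately have card: "card (\<Phi> (s \<otimes> ?x)) + 1 = card (\<Phi> ?x)"
    using \<open>s \<in> \<Phi> ?x\<close> assms(1) y by (simp add: card_image card_Suc_Diff1 del: card_Diff_insert)
  have "inv m \<otimes> (?q \<otimes> y) = s \<otimes> ?x"
    using assms s y by (simp add: conj_by_def flip: m_assoc)
  then have qx: "card (\<Phi> (s \<otimes> ?x)) = card ((\<Phi> m - \<Phi> (?q \<otimes> y)) \<union> (\<Phi> (?q \<otimes> y) - \<Phi> m))"
    using card_inversions_inv_mult[of m "?q \<otimes> y"] assms(1) qc y by simp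
  have f: "finite (\<Phi> m)" "finite (\<Phi> (?q \<otimes> y))" "finite (\<Phi> y)" using assms qc y by auto
  have "card (\<Phi> ?x) = card (\<Phi> m) + card (\<Phi> y)"
    using card_inversions_inv_mult[of m y] assms(1) y card_Un_disjoint[OF f(1,3)]
    by (simp add: Diff_triv Int_commute)
  moreover show less: "card (\<Phi> (?q \<otimes> y)) < card (\<Phi> y)"
    using card_reflection_mult_less[OF y(1) assms(5)] .
  moreover have "card ((\<Phi> m - \<Phi> (?q \<otimes> y)) \<union> (\<Phi> (?q \<otimes> y) - \<Phi> m)) =
      card (\<Phi> m - \<Phi> (?q \<otimes> y)) + card (\<Phi> (?q \<otimes> y) - \<Phi> m)"
    using f by (intro card_Un_disjoint) auto
  moreover have "card (\<Phi> m) = card (\<Phi> m - \<Phi> (?q \<otimes> y)) + card (\<Phi> (?q \<otimes> y) \<inter> \<Phi> m)"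
    using f card_Int_Diff[of "\<Phi> m" "\<Phi> (?q \<otimes> y)"] by (simp add: Int_commute)
  moreover have "card (\<Phi> (?q \<otimes> y)) = card (\<Phi> (?q \<otimes> y) - \<Phi> m) + card (\<Phi> (?q \<otimes> y) \<inter> \<Phi> m)"
    using f card_Int_Diff[of "\<Phi> (?q \<otimes> y)" "\<Phi> m"] by simp
  ultimately have "card (\<Phi> (?q \<otimes> y) \<inter> \<Phi> m) = 0" using card qx by linarith
  then show "?q \<otimes> y \<in> cone m" using f qc y unfolding cone_def by simp
qed

text \<open>
  The key step of Przytycki and Yau: a cone type that does not change along one edge at the top
  of a residue does not change along the opposite side of the residue either.
\<close>

lemma cone_opposite:
  assumes res: "residue z s t m R" and eq: "cone (z \<otimes> s) = cone z"
  shows "cone (z \<otimes> t) = cone m"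
proof (rule ccontr)
  assume neq: "cone (z \<otimes> t) \<noteq> cone m"
  let ?r = "z \<rhd> s" and ?q = "z \<rhd> t"
  obtain t' where t': "t' \<in> S" "?q = m \<rhd> t'" using res unfolding residue_def by blast
  have mc: "m \<in> carrier W" and z: "\<Phi> z = \<Phi> m \<union> R" "\<Phi> m \<inter> R = {}" "?q \<in> R" "?r \<in> R" "?r \<noteq> ?q"
    and conjR: "\<And>\<rho>. \<rho> \<in> R \<Longrightarrow> ?q \<rhd> \<rho> \<in> R"
    and meet: "\<And>y. y \<in> carrier W \<Longrightarrow> \<Phi> y \<inter> R \<noteq> {} \<Longrightarrow> ?r \<in> \<Phi> y \<or> ?q \<in> \<Phi> y"
    using res unfolding residue_def by auto
  have zs: "\<Phi> (z \<otimes> s) = \<Phi> z - {?r}" and zt: "\<Phi> (z \<otimes> t) = \<Phi> z - {?q}"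
    using residue_le(1)[OF res] residue_le(1)[OF residue_sym[OF res]] by auto
  have "cone (z \<otimes> t) \<subseteq> cone m"
    using residue_le(2)[OF residue_sym[OF res]] by (rule cone_antimono)
  then obtain y0 where "y0 \<in> cone m - cone (z \<otimes> t)" using neq by blast
  \<comment> \<open>\<open>y\<close> is a shortest witness for the difference of the two
    cones.\<close>
  from ex_has_least_nat[of "\<lambda>y. y \<in> cone m - cone (z \<otimes> t)", OF this, of "\<lambda>y. card (\<Phi> y)"]
  obtain y where y: "y \<in> cone m - cone (z \<otimes> t)"
    and least: "\<And>k. k \<in> cone m - cone (z \<otimes> t) \<Longrightarrow> card (\<Phi> y) \<le> card (\<Phi> k)" by blast
  have yc: "y \<in> carrier W" and ym: "\<Phi> y \<inter> \<Phi> m = {}" and yR: "\<Phi> y \<inter> (R - {?q}) \<noteq> {}"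
    using y z(1) zt unfolding cone_def by auto
  show False
  proof (cases "?q \<in> \<Phi> y")
    case True
    have qm: "m \<rhd> t' \<notin> \<Phi> m" using z t' by auto
    \<comment> \<open>By \<open>reflection_cone\<close> and minimality the reflected
      \<open>y'\<close> lies in the cone of \<open>z \<otimes> t\<close>, so it meets
      \<open>R\<close> at most in \<open>?q\<close>, and in fact not at all. As conjugation by
      \<open>?q\<close> preserves \<open>R\<close>, reflecting back gives a \<open>y\<close> that
      meets \<open>R\<close> only in \<open>?q\<close>, against \<open>yR\<close>.\<close>
    define y' where "y' = ?q \<otimes> y"
    have qc: "?q \<in> carrier W" using t' mc by auto
    have y': "y' \<in> cone m" "card (\<Phi> y') < card (\<Phi> y)"
      using reflection_cone[OF mc t'(1) qm] y True t'(2) by (auto simp: y'_def)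
    then have "y' \<in> cone (z \<otimes> t)" using least[of y'] by fastforce
    then have y'zt: "\<Phi> y' \<inter> (R - {?q}) = {}" using z zt unfolding cone_def by blast
    have y'c: "y' \<in> carrier W" using qc yc by (simp add: y'_def)
    have qq: "?q \<otimes> ?q = \<one>" using conj_gen_square[OF mc t'(1)] t'(2) by simp
    then have iq: "inv ?q = ?q" using qc by (simp add: inv_equality)
    have yq: "y = ?q \<otimes> y'" using qc yc qq by (simp add: y'_def flip: m_assoc)
    \<comment> \<open>Since \<open>\<Phi> m\<close> misses \<open>R\<close>, only the middle term of
      \<open>mem_inversions_conj\<close> survives on \<open>R\<close>.\<close>
    have memq: "\<rho> \<in> \<Phi> ?q \<longleftrightarrow> \<rho> = ?q" if "\<rho> \<in> R" "\<rho> \<in> carrier W" for \<rho>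
      using mem_inversions_conj[OF mc t'(1) that(2)] z(2) that conjR[OF that(1)] t'(2) by auto
    have conj_q: "?q \<rhd> ?q = ?q" using iq qc qq by (simp add: conj_by_def)
    have "?q \<notin> \<Phi> y'"
      using mem_inversions_mult[OF qc y'c qc] yq iq memq[OF z(3) qc] True conj_q by simp
    then have y'R: "\<Phi> y' \<inter> R = {}" using y'zt by blast
    obtain \<rho> where \<rho>: "\<rho> \<in> \<Phi> y" "\<rho> \<in> R" "\<rho> \<noteq> ?q" using yR by blast
    have "\<rho> \<in> carrier W" using \<rho>(1) by (rule inversions_closed)
    then show False
      using mem_inversions_mult[OF qc y'c, of \<rho>] \<rho> yq iq memq[OF \<rho>(2)] conjR[OF \<rho>(2)] y'R by auto
  next
    case False
    then have r: "?r \<in> \<Phi> y" using meet[OF yc] yR by blast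
    have "y \<noteq> \<one>" using r by auto
    then obtain u where u: "u \<in> S" "y \<rhd> u \<in> \<Phi> y" using right_descent_exists[OF yc] by blast
    have \<Phi>: "\<Phi> (y \<otimes> u) = \<Phi> y - {y \<rhd> u}" using inversions_mult_gen[OF yc u(1)] u(2) by simp
    have "card (\<Phi> (y \<otimes> u)) < card (\<Phi> y)" using \<Phi> u(2) yc card_Diff1_less[of "\<Phi> y"] by simp
    then have "y \<otimes> u \<notin> cone m - cone (z \<otimes> t)" using least[of "y \<otimes> u"] by linarith
    moreover have "y \<otimes> u \<in> cone m" using \<Phi> ym yc u(1) unfolding cone_def by auto
    ultimately have "\<Phi> (y \<otimes> u) \<inter> \<Phi> (z \<otimes> t) = {}" unfolding cone_def by blast
    then have disj: "(\<Phi> y - {y \<rhd> u}) \<inter> (\<Phi> z - {?q}) = {}" using \<Phi> zt by simp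
    have "?r \<in> \<Phi> z - {?q}" using z by blast
    with disj have "?r \<notin> \<Phi> y - {y \<rhd> u}" by (metis IntI empty_iff)
    then have yu: "y \<rhd> u = ?r" using r by simp
    have "\<rho> \<notin> \<Phi> (z \<otimes> s)" if "\<rho> \<in> \<Phi> y" for \<rho>
      using disj that False yu unfolding zs by (metis Diff_iff IntI empty_iff singletonD singletonI)
    then have "\<Phi> y \<inter> \<Phi> (z \<otimes> s) = {}" by auto
    then have "y \<in> cone (z \<otimes> s)" using yc unfolding cone_def by simp
    then have "y \<in> cone z" using eq by simp
    then show False using r z(1,4) unfolding cone_def by blast
  qed
qed

section \<open>Existence, order and joins of gates\<close>

lemma gate_exists:
  assumes w: "w \<in> carrier W"
  obtains g where "is_gate g" "cone g = cone w" "\<Phi> g \<subseteq> \<Phi> w"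
proof -
  let ?U = "{u \<in> carrier W. cone u = cone w}"
  have "?U \<subseteq> carrier W" "?U \<noteq> {}" using w by auto
  moreover have "geodesically_convex ?U" by (rule convex_cone_class)
  moreover have "m \<in> ?U"
    if res: "residue z s t m R" and z: "z \<in> ?U" "z \<otimes> s \<in> ?U" "z \<otimes> t \<in> ?U" for z s t m R
  proof -
    have "cone (z \<otimes> t) = cone m" by (rule cone_opposite[OF res]) (use z in simp)
    then show ?thesis using z res unfolding residue_def by simp
  qed
  ultimately have "\<exists>g\<in>?U. \<forall>u\<in>?U. \<Phi> g \<subseteq> \<Phi> u"
    by (rule convex_peak_closed_least)
  then obtain g where "g \<in> ?U" "\<forall>u\<in>?U. \<Phi> g \<subseteq> \<Phi> u" by blast
  then have "is_gate g" "cone g = cone w" "\<Phi> g \<subseteq> \<Phi> w" using w unfolding is_gate_def by auto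
  then show thesis by (rule that)
qed

lemma gate_unique: "is_gate g \<Longrightarrow> is_gate h \<Longrightarrow> cone g = cone h \<Longrightarrow> g = h"
  unfolding is_gate_def by (intro inversions_inject) auto

text \<open>Induction on the length of \<open>z\<close>, with \<open>a\<close> below some
  \<open>z s\<close> and \<open>g\<close> below some \<open>z t\<close>. Being between
  \<open>g\<close> and \<open>z\<close>, the element \<open>z t\<close> has their cone, so by
  \<open>cone_opposite\<close> the cones of \<open>z s\<close> and the bottom \<open>m\<close>
  agree. By induction \<open>a\<close> is below the gate of that class, hence below \<open>m\<close>
  and \<open>z t\<close>, and induction at \<open>z t\<close> finishes.\<close>

lemma gate_mono:
  assumes "is_gate a" "z \<in> carrier W" "\<Phi> a \<subseteq> \<Phi> z" "is_gate g" "cone g = cone z"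
  shows "\<Phi> a \<subseteq> \<Phi> g"
  using assms(2-)
proof (induction "card (\<Phi> z)" arbitrary: z g rule: less_induct)
  case less
  have ac: "a \<in> carrier W" and gc: "g \<in> carrier W" and gz: "\<Phi> g \<subseteq> \<Phi> z"
    using assms(1) less.prems unfolding is_gate_def by auto
  consider "a = z" | "g = z" | "a \<noteq> z" "g \<noteq> z" by blast
  then show ?case
  proof cases
    case 1
    then show ?thesis using assms(1) gc less.prems(4) unfolding is_gate_def by simp
  next
    case 2
    then show ?thesis using less.prems(2) by simp
  next
    case 3
    obtain s where s: "s \<in> S" "z \<rhd> s \<in> \<Phi> z" "\<Phi> (z \<otimes> s) = \<Phi> z - {z \<rhd> s}" "\<Phi> a \<subseteq> \<Phi> (z \<otimes> s)"
      using step_down[OF ac less.prems(1,2) 3(1)] .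
    obtain t where t: "t \<in> S" "z \<rhd> t \<in> \<Phi> z" "\<Phi> (z \<otimes> t) = \<Phi> z - {z \<rhd> t}" "\<Phi> g \<subseteq> \<Phi> (z \<otimes> t)"
      using step_down[OF gc less.prems(1) gz 3(2)] .
    have c: "z \<otimes> s \<in> carrier W" "z \<otimes> t \<in> carrier W" using less.prems(1) s t by auto
    have ls: "card (\<Phi> (z \<otimes> s)) < card (\<Phi> z)" "card (\<Phi> (z \<otimes> t)) < card (\<Phi> z)"
      using s t less.prems(1) card_Diff1_less[of "\<Phi> z"] by auto
    have "cone z \<subseteq> cone (z \<otimes> t)" "cone (z \<otimes> t) \<subseteq> cone g"
      using t(3,4) by (auto intro!: cone_antimono)
    then have eqt: "cone (z \<otimes> t) = cone z" using less.prems(4) by simp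
    show ?thesis
    proof (cases "s = t")
      case True
      then show ?thesis using less.hyps[OF ls(1) c(1) s(4) less.prems(3)] eqt less.prems(4) by simp
    next
      case False
      obtain m R where res: "residue z s t m R"
        using residue_exists[OF less.prems(1) s(1) t(1) False s(2) t(2)] .
      have opp: "cone (z \<otimes> s) = cone m" by (rule cone_opposite[OF residue_sym[OF res] eqt])
      obtain h where h: "is_gate h" "cone h = cone (z \<otimes> s)" using gate_exists[OF c(1)] .
      have "\<Phi> a \<subseteq> \<Phi> h" using less.hyps[OF ls(1) c(1) s(4) h] .
      also have "\<Phi> h \<subseteq> \<Phi> m"
        using h opp res unfolding is_gate_def residue_def by simp
      also have "\<Phi> m \<subseteq> \<Phi> (z \<otimes> t)" by (rule residue_le(2)[OF residue_sym[OF res]])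
      finally show ?thesis using less.hyps[OF ls(2) c(2) _ less.prems(3)] eqt less.prems(4) by simp
    qed
  qed
qed

text \<open>The gate of the class of \<open>j\<close> is an upper bound of \<open>X\<close> by
  \<open>gate_mono\<close>, so it is above the least one, \<open>j\<close>; it is also below
  \<open>j\<close>.\<close>

lemma gate_join:
  assumes "\<And>x. x \<in> X \<Longrightarrow> is_gate x" "j \<in> carrier W" "\<And>x. x \<in> X \<Longrightarrow> \<Phi> x \<subseteq> \<Phi> j"
    and least: "\<And>u. u \<in> carrier W \<Longrightarrow> (\<And>x. x \<in> X \<Longrightarrow> \<Phi> x \<subseteq> \<Phi> u) \<Longrightarrow> \<Phi> j \<subseteq> \<Phi> u"
  shows "is_gate j"
proof -
  obtain g where g: "is_gate g" "cone g = cone j" "\<Phi> g \<subseteq> \<Phi> j" using gate_exists[OF assms(2)] .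
  have gc: "g \<in> carrier W" using g unfolding is_gate_def by simp
  have "\<Phi> x \<subseteq> \<Phi> g" if "x \<in> X" for x
    using gate_mono[OF assms(1)[OF that] assms(2) assms(3)[OF that] g(1,2)] .
  then have "\<Phi> j \<subseteq> \<Phi> g" using least[OF gc] by blast
  then have "j = g" using g(3) assms(2) gc by (intro inversions_inject) auto
  then show ?thesis using g by simp
qed

text \<open>A generator \<open>s\<close> lies in the cone of \<open>w\<close> exactly when it is no
  inversion of \<open>w\<close>, so every \<open>w\<close> with the cone of \<open>s\<close> is
  above \<open>s\<close>.\<close>

lemma gate_gen:
  assumes "s \<in> S" shows "is_gate s"
proof -
  have "s \<in> \<Phi> w" if "w \<in> carrier W" "cone w = cone s" for w
  proof -
    have "s \<notin> cone s" using assms unfolding cone_def by simp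
    then have "s \<notin> cone w" using that by simp
    then show ?thesis using assms unfolding cone_def by simp
  qed
  then show ?thesis using assms unfolding is_gate_def by simp
qed

section \<open>Reduced products and suffixes of gates\<close>

lemma mem_inversions_mult_disjoint:
  assumes "x \<in> carrier W" "k \<in> carrier W" "\<Phi> k \<inter> \<Phi> (inv x) = {}" "r \<in> carrier W"
  shows "r \<in> \<Phi> (x \<otimes> k) \<longleftrightarrow> r \<in> \<Phi> x \<or> inv x \<rhd> r \<in> \<Phi> k"
  using mem_inversions_mult[of x k r] mem_inversions_inv[of x "inv x \<rhd> r"] assms by auto

text \<open>In a reduced product no inversions cancel: those of \<open>x\<close> are tested against
  \<open>y\<close> directly, those of \<open>k\<close> after translating \<open>y\<close> by
  \<open>inv x\<close>. So \<open>k\<close> enters only through its cone.\<close>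

lemma mem_cone_mult:
  assumes x: "x \<in> carrier W" and k: "k \<in> carrier W" and disj: "\<Phi> k \<inter> \<Phi> (inv x) = {}"
    and y: "y \<in> carrier W"
  shows "y \<in> cone (x \<otimes> k) \<longleftrightarrow> y \<in> cone x \<and> inv x \<otimes> y \<in> cone k"
proof
  assume "y \<in> cone (x \<otimes> k)"
  then have d: "\<Phi> y \<inter> \<Phi> (x \<otimes> k) = {}" unfolding cone_def by simp
  then have "\<Phi> y \<inter> \<Phi> x = {}"
    using mem_inversions_mult_disjoint[OF x k disj] inversions_closed[of _ x] by blast
  moreover have "q \<notin> \<Phi> k" if q: "q \<in> \<Phi> (inv x \<otimes> y)" for q
  proof
    assume "q \<in> \<Phi> k"
    have qc: "q \<in> carrier W" using q by (rule inversions_closed)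
    have "x \<rhd> q \<in> \<Phi> (x \<otimes> k)"
      using mem_inversions_mult_disjoint[OF x k disj, of "x \<rhd> q"] \<open>q \<in> \<Phi> k\<close> x qc by simp
    moreover have "x \<rhd> q \<notin> \<Phi> x" using mem_inversions_inv[OF x qc] disj \<open>q \<in> \<Phi> k\<close> by auto
    ultimately show False using mem_inversions_inv_mult[OF x y qc] q d by auto
  qed
  ultimately show "y \<in> cone x \<and> inv x \<otimes> y \<in> cone k" using x y unfolding cone_def by auto
next
  assume *: "y \<in> cone x \<and> inv x \<otimes> y \<in> cone k"
  have "r \<notin> \<Phi> (x \<otimes> k)" if r: "r \<in> \<Phi> y" for r
  proof
    assume "r \<in> \<Phi> (x \<otimes> k)"
    have rc: "r \<in> carrier W" using r by (rule inversions_closed)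
    have "r \<notin> \<Phi> x" using * r unfolding cone_def by blast
    then have "inv x \<rhd> r \<in> \<Phi> k"
      using mem_inversions_mult_disjoint[OF x k disj rc] \<open>r \<in> \<Phi> (x \<otimes> k)\<close> by blast
    moreover have "inv x \<rhd> r \<in> \<Phi> (inv x \<otimes> y)"
      using mem_inversions_inv_mult[OF x y, of "inv x \<rhd> r"] r \<open>r \<notin> \<Phi> x\<close> x rc by simp
    ultimately show False using * unfolding cone_def by blast
  qed
  then show "y \<in> cone (x \<otimes> k)" using y unfolding cone_def by auto
qed

text \<open>Replace \<open>u\<close> by the gate \<open>h\<close> of its class. By
  \<open>mem_cone_mult\<close> the product keeps its cone, so the gate \<open>x \<otimes> u\<close>
  lies below \<open>x \<otimes> h\<close>. The reverse holds because \<open>h\<close> is below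
  \<open>u\<close>, and cancelling \<open>x\<close> gives \<open>h = u\<close>.\<close>

lemma gate_suffix:
  assumes g: "is_gate (x \<otimes> u)" and x: "x \<in> carrier W" and u: "u \<in> carrier W"
    and disj: "\<Phi> u \<inter> \<Phi> (inv x) = {}"
  shows "is_gate u"
proof -
  obtain h where h: "is_gate h" "cone h = cone u" "\<Phi> h \<subseteq> \<Phi> u" using gate_exists[OF u] .
  have hc: "h \<in> carrier W" using h unfolding is_gate_def by simp
  have disjh: "\<Phi> h \<inter> \<Phi> (inv x) = {}" using disj h(3) by blast
  have "y \<in> cone (x \<otimes> h) \<longleftrightarrow> y \<in> cone (x \<otimes> u)" if "y \<in> carrier W" for y
    using mem_cone_mult[OF x hc disjh that] mem_cone_mult[OF x u disj that] h(2) by simp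
  then have "cone (x \<otimes> h) = cone (x \<otimes> u)" unfolding cone_def by blast
  then have "\<Phi> (x \<otimes> u) \<subseteq> \<Phi> (x \<otimes> h)" using g x hc unfolding is_gate_def by simp
  moreover have "\<Phi> (x \<otimes> h) \<subseteq> \<Phi> (x \<otimes> u)"
    using mem_inversions_mult_disjoint[OF x hc disjh] mem_inversions_mult_disjoint[OF x u disj]
      h(3) inversions_closed by blast
  ultimately have "x \<otimes> h = x \<otimes> u" using x hc u by (intro inversions_inject) auto
  then show ?thesis using h(1) x hc u by simp
qed

lemma len_mult_iff:
  assumes "x \<in> carrier W" "u \<in> carrier W"
  shows "len W S (x \<otimes> u) = len W S x + len W S u \<longleftrightarrow> \<Phi> u \<inter> \<Phi> (inv x) = {}"
proof -
  have "cone_type W S x = cone (inv x)" using cone_type_inv[of "inv x"] assms by simp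
  then show ?thesis using assms unfolding cone_type_def cone_def by blast
qed

section \<open>Garside shadows\<close>

abbreviation weak_order :: "'a gorder" ("\<W>") where
  "\<W> \<equiv> right_weak_order W S"

lemma carrier_weak_order [simp]: "carrier \<W> = carrier W"
  by (simp add: right_weak_order_def)

text \<open>Written out in cardinalities, the defining equation of the order says that
  \<open>\<Phi> x - \<Phi> y\<close> is empty.\<close>

lemma weak_order_iff:
  assumes x: "x \<in> carrier W" and y: "y \<in> carrier W"
  shows "x \<sqsubseteq>\<^bsub>\<W>\<^esub> y \<longleftrightarrow> \<Phi> x \<subseteq> \<Phi> y"
proof -
  have f: "finite (\<Phi> x)" "finite (\<Phi> y)" using x y by auto
  have "card ((\<Phi> x - \<Phi> y) \<union> (\<Phi> y - \<Phi> x)) = card (\<Phi> x - \<Phi> y) + card (\<Phi> y - \<Phi> x)"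
    using f by (intro card_Un_disjoint) auto
  moreover have "card (\<Phi> x) = card (\<Phi> x \<inter> \<Phi> y) + card (\<Phi> x - \<Phi> y)"
    using f card_Int_Diff[of "\<Phi> x" "\<Phi> y"] by simp
  moreover have "card (\<Phi> y) = card (\<Phi> x \<inter> \<Phi> y) + card (\<Phi> y - \<Phi> x)"
    using f card_Int_Diff[of "\<Phi> y" "\<Phi> x"] by (simp add: Int_commute)
  moreover have "card (\<Phi> x - \<Phi> y) = 0 \<longleftrightarrow> \<Phi> x \<subseteq> \<Phi> y" using f by auto
  moreover have "x \<sqsubseteq>\<^bsub>\<W>\<^esub> y \<longleftrightarrow> card ((\<Phi> x - \<Phi> y) \<union> (\<Phi> y - \<Phi> x)) + card (\<Phi> x) = card (\<Phi> y)"
    using x y by (simp add: right_weak_order_def len_eq_card card_inversions_inv_mult)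
  ultimately show ?thesis by linarith
qed

lemma least_weak_order_iff:
  assumes "U \<subseteq> carrier W"
  shows "least \<W> g U \<longleftrightarrow> g \<in> U \<and> (\<forall>u\<in>U. \<Phi> g \<subseteq> \<Phi> u)"
  using assms weak_order_iff unfolding least_def by (auto simp: subset_iff)

lemma Upper_weak_order:
  assumes "X \<subseteq> carrier W"
  shows "Upper \<W> X = {u \<in> carrier W. \<forall>x\<in>X. \<Phi> x \<subseteq> \<Phi> u}"
  using assms weak_order_iff unfolding Upper_def by auto

lemma Upper_closed': "X \<subseteq> carrier W \<Longrightarrow> Upper \<W> X \<subseteq> carrier W"
  by (simp add: Upper_weak_order)

text \<open>The join is a choice among the least upper bounds, and \<open>join_exists\<close>
  provides one to choose.\<close>

lemma sup_least:
  assumes X: "X \<subseteq> carrier W" and b: "Upper \<W> X \<noteq> {}"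
  shows "least \<W> (\<Squnion>\<^bsub>\<W>\<^esub> X) (Upper \<W> X)"
proof -
  obtain b where "b \<in> carrier W" "\<And>x. x \<in> X \<Longrightarrow> \<Phi> x \<subseteq> \<Phi> b"
    using b X Upper_weak_order by auto
  then obtain j where "j \<in> carrier W" "\<And>x. x \<in> X \<Longrightarrow> \<Phi> x \<subseteq> \<Phi> j"
    "\<And>u. u \<in> carrier W \<Longrightarrow> (\<And>x. x \<in> X \<Longrightarrow> \<Phi> x \<subseteq> \<Phi> u) \<Longrightarrow> \<Phi> j \<subseteq> \<Phi> u"
    using join_exists[OF X, of b] by metis
  then have "least \<W> j (Upper \<W> X)"
    using least_weak_order_iff[OF Upper_closed'[OF X]] Upper_weak_order[OF X] by simp
  then show ?thesis unfolding sup_def by (rule someI[of "\<lambda>j. least \<W> j (Upper \<W> X)"])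
qed

lemma sup_props:
  assumes X: "X \<subseteq> carrier W" and b: "Upper \<W> X \<noteq> {}"
  shows "\<Squnion>\<^bsub>\<W>\<^esub> X \<in> carrier W"
    and "\<And>x. x \<in> X \<Longrightarrow> \<Phi> x \<subseteq> \<Phi> (\<Squnion>\<^bsub>\<W>\<^esub> X)"
    and "\<And>u. u \<in> carrier W \<Longrightarrow> (\<And>x. x \<in> X \<Longrightarrow> \<Phi> x \<subseteq> \<Phi> u) \<Longrightarrow> \<Phi> (\<Squnion>\<^bsub>\<W>\<^esub> X) \<subseteq> \<Phi> u"
  using sup_least[OF assms] least_weak_order_iff[OF Upper_closed'[OF X]] Upper_weak_order[OF X]
  by simp_all

lemma cone_class_eq: "cone_class W S T = {w \<in> carrier W. cone w = T}"
  unfolding cone_class_def using cone_type_inv by auto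

lemma gates_eq: "gates W S = {g. is_gate g}"
proof (intro equalityI subsetI)
  fix g assume "g \<in> gates W S"
  then obtain T where "least \<W> g (cone_class W S T)" unfolding gates_def by blast
  then show "g \<in> {g. is_gate g}"
    using least_weak_order_iff[of "cone_class W S T" g] unfolding cone_class_eq is_gate_def by auto
next
  fix g assume "g \<in> {g. is_gate g}"
  then have g: "g \<in> carrier W" "\<forall>w\<in>carrier W. cone w = cone g \<longrightarrow> \<Phi> g \<subseteq> \<Phi> w"
    unfolding is_gate_def by auto
  then have "least \<W> g (cone_class W S (cone g))"
    using least_weak_order_iff[of "cone_class W S (cone g)" g] unfolding cone_class_eq by auto
  moreover have "cone g = cone_type W S (inv g)" using cone_type_inv g by simp
  then have "cone g \<in> cone_type W S ` carrier W" using g by blast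
  ultimately show "g \<in> gates W S" unfolding gates_def by blast
qed

lemma gates_closed_under_join: "closed_under_join W S (gates W S)"
  unfolding closed_under_join_def
proof (intro allI impI)
  fix X assume X: "X \<subseteq> gates W S" and b: "Upper \<W> X \<noteq> {}"
  have gate: "is_gate x" if "x \<in> X" for x using that X gates_eq by auto
  then have Xc: "X \<subseteq> carrier W" unfolding is_gate_def by auto
  have "is_gate (\<Squnion>\<^bsub>\<W>\<^esub> X)"
    by (rule gate_join[OF _ sup_props[OF Xc b]]) (use gate in assumption)+
  then show "\<Squnion>\<^bsub>\<W>\<^esub> X \<in> gates W S" by (simp add: gates_eq)
qed

lemma garside_shadow_gates: "garside_shadow W S (gates W S)"
  unfolding garside_shadow_def
proof (intro conjI ballI impI)
  show "gates W S \<subseteq> carrier W" by (auto simp: gates_eq is_gate_def)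
  show "S \<subseteq> gates W S" by (auto simp: gates_eq gate_gen)
  show "closed_under_join W S (gates W S)" by (rule gates_closed_under_join)
next
  fix w u assume w: "w \<in> gates W S" and u: "u \<in> carrier W" and suf: "is_suffix W S u w"
  have g: "is_gate w" "w \<in> carrier W" using w by (auto simp: gates_eq is_gate_def)
  let ?x = "w \<otimes> inv u"
  have x: "?x \<in> carrier W" "?x \<otimes> u = w" using g u by (simp_all add: m_assoc)
  then have "\<Phi> u \<inter> \<Phi> (inv ?x) = {}"
    using suf len_mult_iff[OF x(1) u] unfolding is_suffix_def by simp
  then have "is_gate u" using gate_suffix[OF _ x(1) u] g x(2) by simp
  then show "u \<in> gates W S" by (simp add: gates_eq)
qed

section \<open>Left multiplication by a generator\<close>

lemma len_gen: "s \<in> S \<Longrightarrow> len W S s = 1"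
  by (simp add: len_eq_card)

lemma len_gen_mult:
  assumes s: "s \<in> S" and w: "w \<in> carrier W"
  shows "s \<notin> \<Phi> w \<Longrightarrow> len W S (s \<otimes> w) = Suc (len W S w)"
    and "s \<in> \<Phi> w \<Longrightarrow> len W S w = Suc (len W S (s \<otimes> w))"
proof -
  have up: "len W S (s \<otimes> v) = Suc (len W S v)" if "v \<in> carrier W" "s \<notin> \<Phi> v" for v
    using len_mult_iff[of s v] that s len_gen[OF s] by auto
  show "s \<notin> \<Phi> w \<Longrightarrow> len W S (s \<otimes> w) = Suc (len W S w)" using up w by blast
  assume "s \<in> \<Phi> w"
  then have "s \<notin> \<Phi> (s \<otimes> w)" using mem_inversions_mult[of s w s] s w by auto
  moreover have "s \<otimes> (s \<otimes> w) = w" using s w gen_square by (simp flip: m_assoc)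
  ultimately show "len W S w = Suc (len W S (s \<otimes> w))" using up[of "s \<otimes> w"] s w by simp
qed

lemma left_descents_eq: "w \<in> carrier W \<Longrightarrow> left_descents W S w = S \<inter> \<Phi> w"
  unfolding left_descents_def using len_gen_mult by fastforce

lemma inversions_gen_mult_subset_iff:
  assumes s: "s \<in> S" and x: "x \<in> carrier W" "s \<notin> \<Phi> x" and y: "y \<in> carrier W" "s \<notin> \<Phi> y"
  shows "\<Phi> (s \<otimes> x) \<subseteq> \<Phi> (s \<otimes> y) \<longleftrightarrow> \<Phi> x \<subseteq> \<Phi> y"
proof
  have mem: "r \<in> \<Phi> (s \<otimes> v) \<longleftrightarrow> (r = s) \<noteq> (s \<rhd> r \<in> \<Phi> v)" if "v \<in> carrier W" "r \<in> carrier W" for v r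
    using mem_inversions_mult[of s v r] s that by simp
  have ss: "s \<rhd> s \<rhd> r = r" if "r \<in> carrier W" for r using conj_by_inv(1)[of s r] s that by simp
  {
    assume le: "\<Phi> (s \<otimes> x) \<subseteq> \<Phi> (s \<otimes> y)"
    show "\<Phi> x \<subseteq> \<Phi> y"
    proof
      fix r assume r: "r \<in> \<Phi> x"
      then have rc: "r \<in> carrier W" by (rule inversions_closed)
      have "s \<rhd> r \<noteq> s" using r x(2) ss[OF rc] s by auto
      then have "s \<rhd> r \<in> \<Phi> (s \<otimes> x)" using mem[OF x(1), of "s \<rhd> r"] r rc ss s by auto
      then have "s \<rhd> r \<in> \<Phi> (s \<otimes> y)" using le by blast
      then show "r \<in> \<Phi> y" using mem[OF y(1), of "s \<rhd> r"] rc ss s \<open>s \<rhd> r \<noteq> s\<close> by auto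
    qed
  next
    assume le: "\<Phi> x \<subseteq> \<Phi> y"
    then show "\<Phi> (s \<otimes> x) \<subseteq> \<Phi> (s \<otimes> y)"
      using inversions_gen_mult(1)[OF s x] inversions_gen_mult(1)[OF s y] by auto
  }
qed

section \<open>The projection to a Garside shadow\<close>

context
  fixes B assumes B: "garside_shadow W S B"
begin

lemma shadow_subset: "B \<subseteq> carrier W"
  using B unfolding garside_shadow_def by simp

lemma gen_shadow: "s \<in> S \<Longrightarrow> s \<in> B"
  using B unfolding garside_shadow_def by blast

abbreviation proj :: "'a \<Rightarrow> 'a" ("\<pi>") where
  "\<pi> \<equiv> shadow_proj W S B"

lemma proj_props:
  assumes w: "w \<in> carrier W"
  shows "\<pi> w \<in> B" "\<pi> w \<in> carrier W" "\<Phi> (\<pi> w) \<subseteq> \<Phi> w"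
    and "\<And>b. b \<in> B \<Longrightarrow> \<Phi> b \<subseteq> \<Phi> w \<Longrightarrow> \<Phi> b \<subseteq> \<Phi> (\<pi> w)"
proof -
  let ?X = "{b \<in> B. b \<sqsubseteq>\<^bsub>\<W>\<^esub> w}"
  have X: "?X \<subseteq> carrier W" using shadow_subset by blast
  have iff: "b \<in> ?X \<longleftrightarrow> b \<in> B \<and> \<Phi> b \<subseteq> \<Phi> w" for b
    using weak_order_iff[OF _ w] shadow_subset by auto
  have "w \<in> Upper \<W> ?X" using iff w unfolding Upper_weak_order[OF X] by auto
  then have ne: "Upper \<W> ?X \<noteq> {}" by blast
  have "?X \<subseteq> B" by blast
  then show "\<pi> w \<in> B"
    using B ne unfolding garside_shadow_def closed_under_join_def shadow_proj_def by blast
  then show "\<pi> w \<in> carrier W" using shadow_subset by blast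
  show "\<Phi> (\<pi> w) \<subseteq> \<Phi> w"
    unfolding shadow_proj_def using sup_props(3)[OF X ne w] iff by blast
  show "\<Phi> b \<subseteq> \<Phi> (\<pi> w)" if "b \<in> B" "\<Phi> b \<subseteq> \<Phi> w" for b
    unfolding shadow_proj_def using sup_props(2)[OF X ne, of b] iff that by blast
qed

lemma proj_one [simp]: "\<pi> \<one> = \<one>"
  using proj_props(2,3)[of \<one>] by simp

lemma gen_mem_inversions_proj_iff:
  assumes "s \<in> S" "w \<in> carrier W"
  shows "s \<in> \<Phi> (\<pi> w) \<longleftrightarrow> s \<in> \<Phi> w"
  using proj_props(3)[OF assms(2)] proj_props(4)[OF assms(2) gen_shadow[OF assms(1)]] assms(1) by auto

text \<open>Removing a left descent leaves a suffix.\<close>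

lemma gen_mult_shadow:
  assumes b: "b \<in> B" and s: "s \<in> S" "s \<in> \<Phi> b"
  shows "s \<otimes> b \<in> B"
proof -
  have bc: "b \<in> carrier W" using b shadow_subset by blast
  have "b \<otimes> inv (s \<otimes> b) = s" using bc s by (simp add: inv_mult_group flip: m_assoc)
  then have "is_suffix W S (s \<otimes> b) b"
    using len_gen_mult(2)[OF s(1) bc s(2)] len_gen[OF s(1)] unfolding is_suffix_def by simp
  then show ?thesis using B b bc s(1) unfolding garside_shadow_def by blast
qed

text \<open>Put \<open>b = \<pi> (s \<otimes> w)\<close>. As \<open>s\<close> is in the shadow and
  below \<open>s \<otimes> w\<close>, it is a descent of \<open>b\<close>, and the suffix
  \<open>s \<otimes> b\<close> of \<open>b\<close> is in the shadow and below \<open>w\<close>. So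
  it is below \<open>\<pi> w\<close>, and multiplying by \<open>s\<close> gives the claim.\<close>

lemma inversions_proj_gen_mult:
  assumes w: "w \<in> carrier W" and s: "s \<in> S" "s \<notin> \<Phi> w"
  shows "\<Phi> (\<pi> (s \<otimes> w)) \<subseteq> \<Phi> (s \<otimes> \<pi> w)"
proof -
  have sw: "s \<otimes> w \<in> carrier W" "s \<in> \<Phi> (s \<otimes> w)"
    using inversions_gen_mult(1)[OF s(1) w s(2)] w s by auto
  let ?b = "\<pi> (s \<otimes> w)"
  have b: "?b \<in> B" "?b \<in> carrier W" "s \<in> \<Phi> ?b"
    using proj_props[OF sw(1)] gen_mem_inversions_proj_iff[OF s(1) sw(1)] sw(2) by auto
  let ?c = "s \<otimes> ?b"
  have c: "?c \<in> B" "?c \<in> carrier W" "s \<notin> \<Phi> ?c"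
    using gen_mult_shadow[OF b(1) s(1) b(3)] b s(1) mem_inversions_mult[of s ?b s] by auto
  have sc: "s \<otimes> ?c = ?b" using s(1) b(2) gen_square by (simp flip: m_assoc)
  have "\<Phi> ?c \<subseteq> \<Phi> w"
    using inversions_gen_mult_subset_iff[OF s(1) c(2,3) w s(2)] proj_props(3)[OF sw(1)] sc by simp
  then have "\<Phi> ?c \<subseteq> \<Phi> (\<pi> w)" using proj_props(4)[OF w c(1)] by blast
  moreover have "s \<notin> \<Phi> (\<pi> w)" using gen_mem_inversions_proj_iff[OF s(1) w] s(2) by simp
  ultimately show ?thesis
    using inversions_gen_mult_subset_iff[OF s(1) c(2,3) proj_props(2)[OF w]] sc by simp
qed

text \<open>Both inequalities come from the maximality of the projection, one of them through
  \<open>inversions_proj_gen_mult\<close>. The identity lets the shadow automaton work with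
  projections in place of the elements themselves.\<close>

lemma proj_gen_mult_proj:
  assumes w: "w \<in> carrier W" and s: "s \<in> S" "s \<notin> \<Phi> w"
  shows "\<pi> (s \<otimes> \<pi> w) = \<pi> (s \<otimes> w)"
proof (rule inversions_inject)
  have pw: "\<pi> w \<in> carrier W" using proj_props[OF w] by simp
  have c: "s \<otimes> w \<in> carrier W" "s \<otimes> \<pi> w \<in> carrier W" using w pw s by auto
  show "\<pi> (s \<otimes> \<pi> w) \<in> carrier W" "\<pi> (s \<otimes> w) \<in> carrier W"
    using proj_props(2)[OF c(1)] proj_props(2)[OF c(2)] by auto
  have "s \<notin> \<Phi> (\<pi> w)" using gen_mem_inversions_proj_iff[OF s(1) w] s(2) by simp
  then have "\<Phi> (s \<otimes> \<pi> w) \<subseteq> \<Phi> (s \<otimes> w)"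
    using inversions_gen_mult_subset_iff[OF s(1) pw _ w s(2)] proj_props(3)[OF w] by blast
  then have "\<Phi> (\<pi> (s \<otimes> \<pi> w)) \<subseteq> \<Phi> (s \<otimes> w)" using proj_props(3)[OF c(2)] by blast
  then have "\<Phi> (\<pi> (s \<otimes> \<pi> w)) \<subseteq> \<Phi> (\<pi> (s \<otimes> w))"
    using proj_props(4)[OF c(1) proj_props(1)[OF c(2)]] by blast
  moreover have "\<Phi> (\<pi> (s \<otimes> w)) \<subseteq> \<Phi> (\<pi> (s \<otimes> \<pi> w))"
    using proj_props(4)[OF c(2) proj_props(1)[OF c(1)]] inversions_proj_gen_mult[OF assms] by blast
  ultimately show "\<Phi> (\<pi> (s \<otimes> \<pi> w)) = \<Phi> (\<pi> (s \<otimes> w))" by blast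
qed

text \<open>The projection may lose inversions but still meets every \<open>\<Phi> y\<close> that
  \<open>\<Phi> w\<close> meets. Induction on the length of \<open>y\<close> with left descent
  \<open>s\<close>: if \<open>s\<close> is in \<open>\<Phi> w\<close>, it is in
  \<open>\<Phi> (\<pi> w)\<close>; otherwise \<open>s \<otimes> y\<close> and
  \<open>s \<otimes> w\<close> still meet, and \<open>inversions_proj_gen_mult\<close> carries the
  meeting from \<open>\<pi> (s \<otimes> w)\<close> back to \<open>\<pi> w\<close>.\<close>

lemma cone_proj:
  assumes w: "w \<in> carrier W" shows "cone (\<pi> w) = cone w"
proof
  show "cone w \<subseteq> cone (\<pi> w)" using proj_props(3)[OF w] by (rule cone_antimono)
  have "\<Phi> y \<inter> \<Phi> (\<pi> w) \<noteq> {}"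
    if "y \<in> carrier W" "w \<in> carrier W" "\<Phi> y \<inter> \<Phi> w \<noteq> {}" for y w
    using that
  proof (induction "card (\<Phi> y)" arbitrary: y w rule: less_induct)
    case less
    note y = less.prems(1) and w = less.prems(2)
    have "inv y \<noteq> \<one>" using less.prems by auto
    then obtain s where "s \<in> S" "inv y \<rhd> s \<in> \<Phi> (inv y)"
      using right_descent_exists[of "inv y"] y by blast
    then have s: "s \<in> S" "s \<in> \<Phi> y" using right_descent_iff[of "inv y" s] y by auto
    show ?case
    proof (cases "s \<in> \<Phi> w")
      case True
      then show ?thesis using gen_mem_inversions_proj_iff[OF s(1) w] s(2) by blast
    next
      case False
      have c: "s \<otimes> y \<in> carrier W" "s \<otimes> w \<in> carrier W" using s y w by auto
      have less': "card (\<Phi> (s \<otimes> y)) < card (\<Phi> y)"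
        using len_gen_mult(2)[OF s(1) y s(2)] len_eq_card y c by simp
      have mem: "r \<in> \<Phi> (s \<otimes> v) \<longleftrightarrow> (r = s) \<noteq> (s \<rhd> r \<in> \<Phi> v)"
        if "v \<in> carrier W" "r \<in> carrier W" for v r
        using mem_inversions_mult[of s v r] s(1) that by simp
      have ss: "s \<rhd> s \<rhd> r = r" if "r \<in> carrier W" for r
        using conj_by_inv(1)[of s r] s(1) that by simp
      obtain r where r: "r \<in> \<Phi> y" "r \<in> \<Phi> w" using less.prems by blast
      have rc: "r \<in> carrier W" using r(1) by (rule inversions_closed)
      have ne: "s \<rhd> r \<noteq> s" using r(2) False ss[OF rc] s(1) by auto
      have "s \<rhd> r \<in> \<Phi> (s \<otimes> y)" "s \<rhd> r \<in> \<Phi> (s \<otimes> w)"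
        using mem[OF y, of "s \<rhd> r"] mem[OF w, of "s \<rhd> r"] r rc ss ne s(1) by auto
      then have "\<Phi> (s \<otimes> y) \<inter> \<Phi> (\<pi> (s \<otimes> w)) \<noteq> {}" using less.hyps[OF less' c] by blast
      then obtain q where q: "q \<in> \<Phi> (s \<otimes> y)" "q \<in> \<Phi> (s \<otimes> \<pi> w)"
        using inversions_proj_gen_mult[OF w s(1) False] by blast
      have qc: "q \<in> carrier W" using q(1) by (rule inversions_closed)
      have "s \<notin> \<Phi> (s \<otimes> y)" using mem[OF y, of s] s by auto
      then have "q \<noteq> s" using q(1) by blast
      then have "s \<rhd> q \<in> \<Phi> y" "s \<rhd> q \<in> \<Phi> (\<pi> w)"
        using mem[OF y qc] mem[OF proj_props(2)[OF w] qc] q by auto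
      then show ?thesis by blast
    qed
  qed
  then show "cone (\<pi> w) \<subseteq> cone w" using w unfolding cone_def by blast
qed

text \<open>\<open>\<pi> g\<close> lies below the gate \<open>g\<close> and has its cone, so it is
  \<open>g\<close>.\<close>

lemma gates_subset_shadow: "gates W S \<subseteq> B"
proof
  fix g assume "g \<in> gates W S"
  then have g: "g \<in> carrier W" "is_gate g" by (auto simp: gates_eq is_gate_def)
  then have "\<Phi> g \<subseteq> \<Phi> (\<pi> g)"
    using cone_proj[OF g(1)] proj_props(2)[OF g(1)] unfolding is_gate_def by blast
  then have "\<pi> g = g" using proj_props(2,3)[OF g(1)] g(1) by (intro inversions_inject) auto
  then show "g \<in> B" using proj_props(1)[OF g(1)] by simp
qed

end

lemma smallest_garside_shadow_eq_gates: "smallest_garside_shadow W S = gates W S"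
  unfolding smallest_garside_shadow_def
  using garside_shadow_gates gates_subset_shadow by blast

section \<open>Automata\<close>

lemma reduced_words_iff:
  "ss \<in> reduced_words W S \<longleftrightarrow> ss \<in> lists S \<and> len W S (word_prod W ss) = length ss"
  unfolding reduced_words_def by simp

lemma len_inv: "w \<in> carrier W \<Longrightarrow> len W S (inv w) = len W S w"
  by (simp add: len_eq_card card_inversions_inv)

text \<open>Passing to the inverse turns appending a letter into multiplication on the left, where
  the inversions of the inverse decide whether the length grows.\<close>

lemma reduced_words_snoc:
  assumes ss: "ss \<in> lists S" and s: "s \<in> S"
  shows "ss @ [s] \<in> reduced_words W S \<longleftrightarrow>
    ss \<in> reduced_words W S \<and> s \<notin> \<Phi> (inv (word_prod W ss))"
proof -
  let ?p = "word_prod W ss"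
  have p: "?p \<in> carrier W" "word_prod W (ss @ [s]) = ?p \<otimes> s"
    using ss s lists_gen_closed[OF ss] by (auto simp: word_prod_append)
  have len: "len W S (?p \<otimes> s) = len W S (s \<otimes> inv ?p)"
    using len_inv[of "?p \<otimes> s"] p s by (simp add: inv_mult_group)
  have "len W S ?p \<le> length ss" by (rule len_le[OF ss])
  then show ?thesis
    using len_gen_mult[OF s, of "inv ?p"] len len_inv[OF p(1)] p ss s
    unfolding reduced_words_iff by (cases "s \<in> \<Phi> (inv ?p)") auto
qed

lemma run_Nil [simp]: "run A [] = Some (start A)"
  by (simp add: run_def)

lemma run_snoc: "run A (ss @ [s]) = Option.bind (run A ss) (\<lambda>q. trans A q s)"
  by (simp add: run_def)

lemma run_append_cong: "run A u = run A v \<Longrightarrow> run A (u @ w) = run A (v @ w)"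
  by (simp add: run_def)

context
  fixes B assumes B: "garside_shadow W S B"
begin

text \<open>The automaton multiplies on the left, hence the inverse of the product of the word. An
  element and its projection have the same left descents, so exactly the words that are not reduced
  reach the dead state.\<close>

lemma run_shadow_automaton:
  "ss \<in> lists S \<Longrightarrow> run (shadow_automaton W S B) ss =
    (if ss \<in> reduced_words W S then Some (shadow_proj W S B (inv (word_prod W ss))) else None)"
proof (induction ss rule: rev_induct)
  case Nil
  have "len W S \<one> = 0" by (simp add: len_eq_card)
  then show ?case using proj_one[OF B] by (simp add: reduced_words_iff shadow_automaton_def)
next
  case (snoc s ss)
  then have ss: "ss \<in> lists S" and s: "s \<in> S" by auto
  let ?w = "inv (word_prod W ss)"
  have w: "?w \<in> carrier W" using ss by simp
  have inv: "inv (word_prod W (ss @ [s])) = s \<otimes> ?w"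
    using ss s lists_gen_closed[OF ss] by (simp add: word_prod_append inv_mult_group)
  have "s \<in> left_descents W S (shadow_proj W S B ?w) \<longleftrightarrow> s \<in> \<Phi> ?w"
    using left_descents_eq proj_props(2)[OF B w] gen_mem_inversions_proj_iff[OF B s w] s by simp
  then show ?case
    using snoc.IH[OF ss] reduced_words_snoc[OF ss s] proj_gen_mult_proj[OF B w s] inv
    by (simp add: run_snoc shadow_automaton_def)
qed

lemma is_automaton_shadow_automaton: "is_automaton S (shadow_automaton W S B)"
proof -
  have "\<one> \<in> B" using proj_props(1)[OF B one_closed] proj_one[OF B] by simp
  moreover have "shadow_proj W S B (s \<otimes> w) \<in> B" if "w \<in> B" "s \<in> S" for w s
    using proj_props(1)[OF B] shadow_subset[OF B] that by blast
  ultimately show ?thesis unfolding is_automaton_def shadow_automaton_def by auto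
qed

lemma recognised_shadow_automaton: "recognised S (shadow_automaton W S B) = reduced_words W S"
proof (intro equalityI subsetI)
  fix ss assume "ss \<in> recognised S (shadow_automaton W S B)"
  then show "ss \<in> reduced_words W S"
    unfolding recognised_def using run_shadow_automaton[of ss] by (auto split: if_splits)
next
  fix ss assume red: "ss \<in> reduced_words W S"
  then have ss: "ss \<in> lists S" unfolding reduced_words_iff by simp
  then have "shadow_proj W S B (inv (word_prod W ss)) \<in> B" using proj_props(1)[OF B] by simp
  then show "ss \<in> recognised S (shadow_automaton W S B)"
    unfolding recognised_def using run_shadow_automaton[OF ss] red ss
    by (simp add: shadow_automaton_def)
qed

end

text \<open>
  If the reduced words of \<open>inv g\<close> and \<open>inv h\<close> lead to the same state, then they have the same
  reduced continuations, hence \<open>inv g\<close> and \<open>inv h\<close> have the same cone type.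
\<close>

lemma gates_lepoll_states:
  assumes rec: "recognised S A = reduced_words W S"
  shows "gates W S \<lesssim> states A"
proof -
  have "\<exists>ss. ss \<in> reduced_words W S \<and> word_prod W ss = w" if "w \<in> carrier W" for w
  proof -
    obtain ss where "ss \<in> lists S" "word_prod W ss = w" "length ss = len W S w"
      using reduced_word_exists[OF \<open>w \<in> carrier W\<close>] .
    then show ?thesis unfolding reduced_words_iff by auto
  qed
  then obtain red where red: "\<And>w. w \<in> carrier W \<Longrightarrow> red w \<in> reduced_words W S"
    "\<And>w. w \<in> carrier W \<Longrightarrow> word_prod W (red w) = w" by metis
  have red_lists: "red w \<in> lists S" "length (red w) = len W S w" if "w \<in> carrier W" for w
    using red[OF that] unfolding reduced_words_iff by auto
  \<comment> \<open>For \<open>g\<close> in the group the word \<open>red (inv g)\<close> is reduced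
    and hence ends in a live state, so \<open>the\<close> is not applied to the dead state.\<close>
  define f where "f g = the (run A (red (inv g)))" for g
  have run: "run A (red w) \<in> Some ` states A" if "w \<in> carrier W" for w
    using red(1)[OF that] rec unfolding recognised_def by blast
  have gc: "g \<in> carrier W" if "g \<in> gates W S" for g
    using that unfolding gates_eq is_gate_def by simp
  \<comment> \<open>The words \<open>red (inv g)\<close> and \<open>red y\<close> have the lengths
    of \<open>inv g\<close> and \<open>y\<close>, so their concatenation is reduced exactly when
    these lengths add.\<close>
  have mem: "y \<in> cone g \<longleftrightarrow> red (inv g) @ red y \<in> recognised S A"
    if g: "g \<in> carrier W" and y: "y \<in> carrier W" for g y
  proof -
    have ig: "inv g \<in> carrier W" using g by simp
    have "red (inv g) @ red y \<in> reduced_words W S \<longleftrightarrow>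
        len W S (inv g \<otimes> y) = len W S (inv g) + len W S y"
      using red(2)[OF ig] red(2)[OF y] red_lists[OF ig] red_lists[OF y]
      unfolding reduced_words_iff by (simp add: word_prod_append lists_gen_closed del: in_lists_conv_set)
    also have "\<dots> \<longleftrightarrow> y \<in> cone_type W S (inv g)" using y unfolding cone_type_def by simp
    finally show ?thesis using cone_type_inv[OF g] rec by simp
  qed
  have "inj_on f (gates W S)"
  proof (rule inj_onI)
    fix g h assume g: "g \<in> gates W S" and h: "h \<in> gates W S" and eq: "f g = f h"
    have c: "g \<in> carrier W" "h \<in> carrier W" using gc g h by auto
    then have "run A (red (inv g)) = run A (red (inv h))"
      using run[of "inv g"] run[of "inv h"] eq unfolding f_def by auto
    then have same: "run A (red (inv g) @ w) = run A (red (inv h) @ w)" for w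
      by (rule run_append_cong)
    have "y \<in> cone g \<longleftrightarrow> y \<in> cone h" if y: "y \<in> carrier W" for y
      using mem[OF c(1) y] mem[OF c(2) y] same[of "red y"] red_lists(1)[of "inv g"]
        red_lists(1)[of "inv h"] red_lists(1)[OF y] c
      unfolding recognised_def by (simp del: in_lists_conv_set)
    then have "cone g = cone h" unfolding cone_def by blast
    then show "g = h" using gate_unique g h unfolding gates_eq by simp
  qed
  moreover have "f ` gates W S \<subseteq> states A"
  proof
    fix q assume "q \<in> f ` gates W S"
    then obtain g where "g \<in> gates W S" "q = f g" by blast
    then show "q \<in> states A" using run[of "inv g"] gc unfolding f_def by auto
  qed
  ultimately show ?thesis unfolding lepoll_def by blast
qed

lemma minimal_shadow_automaton_gates:
  "minimal_automaton S (reduced_words W S) (shadow_automaton W S (gates W S))"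
proof -
  have "states (shadow_automaton W S (gates W S)) = gates W S"
    by (simp add: shadow_automaton_def)
  then show ?thesis
    unfolding minimal_automaton_def
    using is_automaton_shadow_automaton[OF garside_shadow_gates]
      recognised_shadow_automaton[OF garside_shadow_gates] gates_lepoll_states
    by auto
qed

end

theorem theorem4p32:
  fixes W :: "('a, 'b) monoid_scheme" and S :: "'a set"
  assumes "coxeter_system W S" and "finite S"
  shows "minimal_automaton S (reduced_words W S)
           (shadow_automaton W S (smallest_garside_shadow W S))
         \<longleftrightarrow> closed_under_join W S (gates W S)"
proof -
  interpret coxeter_group W S
    using assms(1)
    by (intro coxeter_group.intro coxeter_group_axioms.intro) (simp_all add: coxeter_system_def)
  show ?thesis
    using minimal_shadow_automaton_gates gates_closed_under_join
    by (simp add: smallest_garside_shadow_eq_gates)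
qed

end
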